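(* Let $n=mK$, and let $A$ be drawn from the balanced planted partition model $\mathrm{PP}^{\mathrm{bal}}_{m,K}(p,q)$, $p>q$, with true cluster matrix $X_0=I_K\otimes E_m$. For any $c_1,c_2>0$, let $$C_1:=\max\{C',\tfrac49(c_1+1)\},\qquad C_2:=C+\max\{\sqrt{4(c_1+1)},\;3\sqrt{4(c_2+1)}\}.$$ Assume $\tilde p\ge C_1$. Then, if $$\tilde p-\tilde q>C_2\big(\sqrt{\tilde p}+\sqrt{\tilde q K}\big),$$ SDP-$2'$ is strongly consistent (i.e. $X_0$ is the unique solution of SDP-$2'$ with input $A$) with probability at least $1-c(Km^{-r}+n^{-r})-n^{-c_1}-2m^{-1}n^{-c_2}$.
   Context: **Model.** Let $n=mK$ and let $S_1,\dots,S_K$ be the consecutive blocks of size $m$ partitioning $[n]$. $A\sim\mathrm{PP}^{\mathrm{bal}}_{m,K}(p,q)$ means: $A$ is a symmetric $n\times n$ matrix whose entries $A_{ij}$, $i<j$, are independent Bernoulli variables with mean $p$ if $i,j$ are in the same block and $q$ otherwise. Diagonal entries of $A$ are not part of the observed data; by convention they are defined so that $\mathbb E A_{ii}=p$ (they do not affect the solution set of the SDP below because $\mathrm{diag}(X)$ is fixed). $E_m$ denotes the $m\times m$ all-ones matrix and $\mathbf 1_n$ the all-ones vector in $\mathbb R^n$. **Scaled parameters.** $\tilde p:=pm/\log n$, $\tilde q:=qm/\log n$. **SDP-$2'$:** maximize $\langle A,X\rangle=\mathrm{tr}(AX)$ over symmetric $X\in\mathbb R^{n\times n}$ subject to $\langle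 E_n,X\rangle=n^2/K$, $\mathrm{diag}(X)=\mathbf 1_n$, $X\succeq 0$ (positive semidefinite), $X\ge 0$ (entrywise). **Constants.** $(C,C',c,r)$ are fixed universal positive constants with the following (known) property: for every $N$ and every symmetric random matrix $B\in\{0,1\}^{N\times N}$ with independent lower-triangular entries and zero diagonal, if $\max_{ij}\mathrm{Var}(B_{ij})\le\sigma^2$ with $N\sigma^2\ge C'\log N$, then with probability at least $1-cN^{-r}$ one has $\|B-\mathbb E B\|\le C\sigma\sqrt N$ (operator norm). *)

theory Defs
  imports "HOL-Probability.Probability" "Jordan_Normal_Form.Matrix"
begin

section \<open>Matrices\<close>

definition mat_trace :: "real mat \<Rightarrow> real" where
  "mat_trace A = (\<Sum>i<dim_row A. A $$ (i, i))"

definition mat_inner :: "real mat \<Rightarrow> real mat \<Rightarrow> real" where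
  "mat_inner A X = mat_trace (A * X)"

definition symmetric_mat :: "real mat \<Rightarrow> bool" where
  "symmetric_mat A \<longleftrightarrow> transpose_mat A = A"

definition psd_mat :: "real mat \<Rightarrow> bool" where
  "psd_mat A \<longleftrightarrow> symmetric_mat A \<and>
     (\<forall>v \<in> carrier_vec (dim_col A). scalar_prod v (A *\<^sub>v v) \<ge> 0)"

definition all_ones_mat :: "nat \<Rightarrow> real mat" where
  "all_ones_mat d = Matrix.mat d d (\<lambda>_. 1)"

definition kronecker :: "real mat \<Rightarrow> real mat \<Rightarrow> real mat" where
  "kronecker A B = Matrix.mat (dim_row A * dim_row B) (dim_col A * dim_col B)
     (\<lambda>(i, j). A $$ (i div dim_row B, j div dim_col B) * B $$ (i mod dim_row B, j mod dim_col B))"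

definition euclidean_norm :: "real Matrix.vec \<Rightarrow> real" where
  "euclidean_norm v = sqrt (scalar_prod v v)"

definition operator_norm :: "real mat \<Rightarrow> real" where
  "operator_norm A =
     (SUP v \<in> {v \<in> carrier_vec (dim_col A). euclidean_norm v \<le> 1}. euclidean_norm (A *\<^sub>v v))"


section \<open>The constants of the spectral-norm concentration bound\<close>

text \<open>
  A random matrix with entries in \<open>{0, 1}\<close> enters only through its law, and this law is
  discrete. So "every random matrix \<open>B\<close>" is rendered as "every \<open>D :: real mat pmf\<close>",
  with \<open>B\<close> drawn from \<open>D\<close>; this covers random matrices on arbitrary probability spaces.
\<close>

definition symmetric_01_law :: "nat \<Rightarrow> real mat pmf \<Rightarrow> bool" where
  "symmetric_01_law N D \<longleftrightarrow>
     (\<forall>B \<in> set_pmf D. B \<in> carrier_mat N N \<and> symmetric_mat B \<and>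
        (\<forall>i<N. \<forall>j<N. B $$ (i, j) \<in> {0, 1}) \<and> (\<forall>i<N. B $$ (i, i) = 0)) \<and>
     prob_space.indep_vars (measure_pmf D) (\<lambda>_. borel) (\<lambda>(i, j) B. B $$ (i, j))
        {(i, j). j < i \<and> i < N}"

definition mean_mat :: "nat \<Rightarrow> real mat pmf \<Rightarrow> real mat" where
  "mean_mat N D = Matrix.mat N N (\<lambda>(i, j). measure_pmf.expectation D (\<lambda>B. B $$ (i, j)))"

definition concentration_constants :: "real \<Rightarrow> real \<Rightarrow> real \<Rightarrow> real \<Rightarrow> bool" where
  "concentration_constants C C' c r \<longleftrightarrow>
     C > 0 \<and> C' > 0 \<and> c > 0 \<and> r > 0 \<and>
     (\<forall>N \<ge> 1. \<forall>D \<sigma>.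
        symmetric_01_law N D \<and> \<sigma> \<ge> 0 \<and>
        (\<forall>i<N. \<forall>j<N. measure_pmf.variance D (\<lambda>B. B $$ (i, j)) \<le> \<sigma>\<^sup>2) \<and>
        real N * \<sigma>\<^sup>2 \<ge> C' * ln (real N)
        \<longrightarrow> measure_pmf.prob D {B. operator_norm (B - mean_mat N D) \<le> C * \<sigma> * sqrt (real N)}
              \<ge> 1 - c * real N powr (- r))"


section \<open>The balanced planted partition model\<close>

text \<open>
  Indices are \<open>0, \<dots>, m * K - 1\<close>, so the consecutive blocks of size \<open>m\<close> are the
  classes of \<open>i div m\<close>. A \<open>{0, 1}\<close>-valued variable is Bernoulli with parameter its mean.
  The diagonal is constrained only through its mean: it need not be
  \<open>{0, 1}\<close>-valued or independent of the other entries.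
\<close>

definition planted_partition_bal ::
    "'w measure \<Rightarrow> nat \<Rightarrow> nat \<Rightarrow> real \<Rightarrow> real \<Rightarrow> ('w \<Rightarrow> real mat) \<Rightarrow> bool" where
  "planted_partition_bal M m K p q A \<longleftrightarrow>
     (\<forall>\<omega> \<in> space M. A \<omega> \<in> carrier_mat (m * K) (m * K) \<and> symmetric_mat (A \<omega>)) \<and>
     prob_space.indep_vars M (\<lambda>_. borel) (\<lambda>(i, j) \<omega>. A \<omega> $$ (i, j))
        {(i, j). i < j \<and> j < m * K} \<and>
     (\<forall>i j. i < j \<and> j < m * K \<longrightarrow>
        (\<forall>\<omega> \<in> space M. A \<omega> $$ (i, j) \<in> {0, 1}) \<and>
        integral\<^sup>L M (\<lambda>\<omega>. A \<omega> $$ (i, j)) = (if i div m = j div m then p else q)) \<and>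
     (\<forall>i < m * K. integrable M (\<lambda>\<omega>. A \<omega> $$ (i, i)) \<and>
        integral\<^sup>L M (\<lambda>\<omega>. A \<omega> $$ (i, i)) = p)"

definition true_cluster_mat :: "nat \<Rightarrow> nat \<Rightarrow> real mat" where
  "true_cluster_mat m K = kronecker (1\<^sub>m K) (all_ones_mat m)"

definition scaled_param :: "nat \<Rightarrow> nat \<Rightarrow> real \<Rightarrow> real" where
  "scaled_param m n x = x * real m / ln (real n)"


section \<open>The semidefinite program\<close>

definition sdp2'_feasible :: "nat \<Rightarrow> nat \<Rightarrow> real mat \<Rightarrow> bool" where
  "sdp2'_feasible n K X \<longleftrightarrow>
     X \<in> carrier_mat n n \<and> symmetric_mat X \<and>
     mat_inner (all_ones_mat n) X = (real n)\<^sup>2 / real K \<and>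
     (\<forall>i<n. X $$ (i, i) = 1) \<and>
     psd_mat X \<and>
     (\<forall>i<n. \<forall>j<n. X $$ (i, j) \<ge> 0)"

definition sdp2'_solution :: "nat \<Rightarrow> nat \<Rightarrow> real mat \<Rightarrow> real mat \<Rightarrow> bool" where
  "sdp2'_solution n K A X \<longleftrightarrow>
     sdp2'_feasible n K X \<and> (\<forall>Y. sdp2'_feasible n K Y \<longrightarrow> mat_inner A Y \<le> mat_inner A X)"

end

theory Submission
  imports Defs
begin

text \<open>
  A dual certificate. On block-centred vectors \<open>u\<close> the mean of \<open>A\<close> vanishes, so \<open>X\<^sub>0\<close> is
  the unique optimum as soon as every vertex has within-block degree larger than
  \<open>\<mu> m + \<parallel>A - E A\<parallel>\<close>, where \<open>\<mu> m\<close> dominates, for all \<open>i, j\<close> in different blocks \<open>S, T\<close>, the number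
  of neighbours of \<open>i\<close> in \<open>T\<close> plus that of \<open>j\<close> in \<open>S\<close> minus the average over \<open>S\<close>.
  The noise is split into the diagonal blocks (variance at most \<open>p\<close>) and the rest, where the
  variance bound is raised to \<open>max q (C' log n / n)\<close> because \<open>q\<close> may be too small for the
  concentration property. This loss is affordable: the separation hypothesis forces
  \<open>n \<ge> p m \<ge> 36 log n\<close>, hence \<open>log n \<ge> 4\<close>, while the spectral noise is of order \<open>sqrt (log n)\<close>
  and the hypothesis provides for order \<open>log n\<close>.
\<close>

section \<open>Blocks and quadratic forms\<close>

text \<open>One spectral bound for the whole noise matrix would have to use the variance
  \<open>p\<close> everywhere and cost a term of order \<open>sqrt (p * n)\<close>; splitting the
  noise replaces it by \<open>sqrt (p * m) + sqrt (q * n)\<close>, the shape of the separation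
  hypothesis. The price is one use of the concentration property per block, hence the summand
  \<open>K * m powr (- r)\<close> of the failure probability. The other summands are union bounds
  over vertices, over pairs of a vertex and a foreign block, and over pairs of blocks. Two features
  of the model shape the route. The diagonal of \<open>A\<close> is known only through its mean; as
  feasible matrices have unit diagonal, it shifts the objective by a constant and can be replaced.
  The concentration property speaks of discrete laws, whereas \<open>A\<close> lives on an arbitrary
  probability space; since the off-diagonal entries form a finite Boolean configuration, all
  estimates are made under a product of Bernoulli laws on the edges and carried over at the
  end.\<close>

lemma sum_blocks:
  fixes f :: "nat \<Rightarrow> 'a :: comm_monoid_add"
  shows "(\<Sum>i<m * K. f i) = (\<Sum>k<K. \<Sum>i\<in>{k * m..<k * m + m}. f i)"
proof (induction K)
  case (Suc K)
  have "{..<m * Suc K} = {..<m * K} \<union> {K * m..<K * m + m}"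
    by (auto simp: mult.commute[of K m])
  then show ?case
    using Suc by (simp add: sum.union_disjoint ivl_disj_int mult.commute[of K m])
qed simp

lemma block_iff:
  fixes i k m :: nat
  assumes "0 < m"
  shows "i \<in> {k * m..<k * m + m} \<longleftrightarrow> i div m = k"
proof
  assume "i \<in> {k * m..<k * m + m}"
  then show "i div m = k" by (intro div_nat_eqI) (auto simp: mult.commute)
next
  assume "i div m = k"
  then show "i \<in> {k * m..<k * m + m}"
    using div_mult_mod_eq[of i m] mod_less_divisor[OF assms, of i] by auto
qed

definition block :: "nat \<Rightarrow> nat \<Rightarrow> nat set" where
  "block m k = {k * m..<k * m + m}"

lemma card_block: "card (block m k) = m"
  by (simp add: block_def)

lemma finite_block: "finite (block m k)"
  by (simp add: block_def)

lemma in_block_iff: "0 < m \<Longrightarrow> i \<in> block m k \<longleftrightarrow> i div m = k"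
  unfolding block_def by (rule block_iff)

lemma block_less:
  assumes "i \<in> block m k" "k < K"
  shows "i < m * K"
proof -
  have "Suc k * m \<le> m * K" using assms(2) by (metis Suc_leI mult.commute mult_le_mono2)
  then show ?thesis using assms(1) by (simp add: block_def)
qed

lemma sum_block_shift: "sum f (block m k) = (\<Sum>i<m. f (k * m + i))"
  unfolding block_def
  by (rule sum.reindex_bij_witness[of _ "\<lambda>i. k * m + i" "\<lambda>i. i - k * m"]) auto

definition block_centered :: "nat \<Rightarrow> nat \<Rightarrow> (nat \<Rightarrow> real) \<Rightarrow> bool" where
  "block_centered m K u \<longleftrightarrow> (\<forall>k<K. (\<Sum>i\<in>block m k. u i) = 0)"

lemma sum_block_const:
  assumes "0 < m"
  shows "(\<Sum>i\<in>block m k. f i (i div m)) = (\<Sum>i\<in>block m k. f i k)"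
  using block_iff[OF assms] by (intro sum.cong) (auto simp: block_def)

lemma sum_block_wise_mult:
  fixes u :: "nat \<Rightarrow> real"
  assumes "0 < m"
  shows "(\<Sum>i<m * K. g (i div m) * u i) = (\<Sum>k<K. g k * (\<Sum>i\<in>block m k. u i))"
  unfolding sum_blocks block_def[symmetric] sum_distrib_left
  by (intro sum.cong refl sum_block_const[OF assms])

lemma sum_block_wise_mult_centered:
  assumes "0 < m" "block_centered m K u"
  shows "(\<Sum>i<m * K. g (i div m) * u i) = 0"
  using assms by (simp add: sum_block_wise_mult block_centered_def)

lemma sum_same_block:
  fixes f :: "nat \<Rightarrow> real"
  assumes "0 < m" "i < m * K"
  shows "(\<Sum>j<m * K. if i div m = j div m then f j else 0) = (\<Sum>j\<in>block m (i div m). f j)"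
proof -
  have "i div m < K" using assms by (simp add: less_mult_imp_div_less mult.commute)
  then have "block m (i div m) \<subseteq> {..<m * K}"
    using block_less by auto
  then show ?thesis
    using block_iff[OF assms(1)]
    by (intro sum.mono_neutral_cong_right) (auto simp: block_def)
qed

section \<open>Quadratic forms and Gram factorization of positive semidefinite matrices\<close>

definition quad_form :: "nat \<Rightarrow> (nat \<Rightarrow> nat \<Rightarrow> real) \<Rightarrow> (nat \<Rightarrow> real) \<Rightarrow> real" where
  "quad_form n X v = (\<Sum>i<n. \<Sum>j<n. X i j * v i * v j)"

text \<open>Nonnegativity of this quadratic polynomial in \<open>t\<close> is all that elimination
  at the pivot \<open>k\<close> uses: it yields the sign of the pivot, the zero row below a zero
  pivot, and positivity of the Schur complement.\<close>

lemma quad_form_add_unit: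
  assumes "k < n" and sym: "\<And>i. i < n \<Longrightarrow> X i k = X k i"
  shows "quad_form n X (\<lambda>i. v i + (if i = k then t else 0)) =
    quad_form n X v + 2 * t * (\<Sum>j<n. X k j * v j) + t\<^sup>2 * X k k"
proof -
  define e where "e i = (if i = k then t else 0)" for i
  have pick: "(\<Sum>i<n. f i * e i) = f k * t" for f :: "nat \<Rightarrow> real"
    using \<open>k < n\<close> by (simp add: e_def if_distrib[of "\<lambda>x. _ * x"] cong: if_cong)
  have inner: "(\<Sum>j<n. X i j * (v i + e i) * (v j + e j))
      = (\<Sum>j<n. X i j * v i * v j) + X i k * v i * t + (\<Sum>j<n. X i j * v j) * e i + X i k * t * e i" for i
  proof -
    have "(\<Sum>j<n. X i j * (v i + e i) * (v j + e j)) =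
       (\<Sum>j<n. X i j * v i * v j + (X i j * v i) * e j + X i j * v j * e i + (X i j * e i) * e j)"
      by (intro sum.cong) (auto simp: algebra_simps)
    also have "\<dots> = (\<Sum>j<n. X i j * v i * v j) + X i k * v i * t + (\<Sum>j<n. X i j * v j) * e i
        + X i k * e i * t"
      unfolding sum.distrib pick by (simp add: sum_distrib_right)
    finally show ?thesis by (simp add: algebra_simps)
  qed
  have "quad_form n X (\<lambda>i. v i + e i) = quad_form n X v + (\<Sum>i<n. X i k * v i * t)
      + (\<Sum>j<n. X k j * v j) * t + X k k * t * t"
    unfolding quad_form_def inner sum.distrib pick ..
  also have "(\<Sum>i<n. X i k * v i * t) = (\<Sum>j<n. X k j * v j) * t"
    unfolding sum_distrib_right using sym by (intro sum.cong) auto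
  finally show ?thesis by (simp add: e_def power2_eq_square algebra_simps)
qed

lemma sum_mult_unit:
  fixes f :: "nat \<Rightarrow> real"
  assumes "k < n"
  shows "(\<Sum>j<n. f j * (if j = k then t else 0)) = f k * t"
  using assms by (simp add: if_distrib[of "\<lambda>x. _ * x"] cong: if_cong)

lemma nonneg_affine_slope_zero:
  fixes a b :: real
  assumes "\<And>t. 0 \<le> a + t * b"
  shows "b = 0"
proof (rule ccontr)
  assume "b \<noteq> 0"
  then have "a + (- (a + 1) / b) * b = -1" by simp
  with assms[of "- (a + 1) / b"] show False by simp
qed

text \<open>Symmetric Gaussian elimination, one pivot at a time; a zero pivot of a positive
  semidefinite matrix has a zero row, which agrees with the convention \<open>x / 0 = 0\<close>.\<close>

lemma psd_gram_from:
  assumes "k \<le> n"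
    and "\<And>i j. i < n \<Longrightarrow> j < n \<Longrightarrow> X i j = X j i"
    and "\<And>v. 0 \<le> quad_form n X v"
    and "\<And>i j. i < k \<Longrightarrow> j < n \<Longrightarrow> X i j = 0"
  shows "\<exists>x. \<forall>i<n. \<forall>j<n. X i j = (\<Sum>r\<in>{k..<n}. x r i * x r j)"
  using assms
proof (induction "n - k" arbitrary: k X)
  case 0
  then show ?case by (intro exI[of _ "\<lambda>_ _. 0"]) auto
next
  case (Suc l)
  then have kn: "k < n" by simp
  note sym = Suc.prems(2) and psd = Suc.prems(3) and zero = Suc.prems(4)
  define d where "d = X k k"
  define g where "g v = (\<Sum>j<n. X k j * v j)" for v
  have quad: "quad_form n X (\<lambda>i. v i + (if i = k then t else 0)) = quad_form n X v + 2 * t * g v + t\<^sup>2 * d"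
    for v t
    unfolding g_def d_def by (rule quad_form_add_unit[OF kn]) (use sym kn in auto)
  have "quad_form n X (\<lambda>_. 0) = 0" by (simp add: quad_form_def)
  then have d0: "0 \<le> d"
    using psd[of "\<lambda>i. 0 + (if i = k then 1 else 0)"] quad[of "\<lambda>_. 0" 1] by (simp add: g_def)
  \<comment> \<open>For a zero pivot the polynomial is affine and nonnegative in the perturbation,
    so its slope vanishes; perturbing by \<open>t / 2\<close> absorbs the factor 2.\<close>
  have g_zero: "g v = 0" if "d = 0" for v
  proof (rule nonneg_affine_slope_zero)
    fix t
    show "0 \<le> quad_form n X v + t * g v"
      using psd[of "\<lambda>i. v i + (if i = k then t / 2 else 0)"] quad[of v "t / 2"] that by simp
  qed
  have row_zero: "X k j = 0" if "d = 0" "j < n" for j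
    using g_zero[OF that(1), of "\<lambda>i. if i = j then 1 else 0"]
    sum_mult_unit[OF that(2), of "X k" 1] by (simp add: g_def)
  define X' where "X' i j = X i j - X k i * X k j / d" for i j
  have "quad_form n X' v = quad_form n X v - (g v)\<^sup>2 / d" for v
  proof -
    have "quad_form n X' v = quad_form n X v - (\<Sum>i<n. \<Sum>j<n. (X k i * v i) * (X k j * v j) / d)"
      unfolding quad_form_def X'_def sum_subtractf[symmetric]
      by (intro sum.cong) (auto simp: algebra_simps)
    also have "(\<Sum>i<n. \<Sum>j<n. (X k i * v i) * (X k j * v j) / d) = (g v)\<^sup>2 / d"
      unfolding g_def power2_eq_square sum_product sum_divide_distrib ..
    finally show ?thesis .
  qed
  moreover have "0 \<le> quad_form n X v - (g v)\<^sup>2 / d" for v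
  proof (cases "d = 0")
    case False
    \<comment> \<open>The perturbation \<open>- g v / d\<close> minimises the polynomial, and the
      minimum is the quadratic form of the Schur complement \<open>X'\<close> at
      \<open>v\<close>.\<close>
    have "0 \<le> quad_form n X v + 2 * (- g v / d) * g v + (- g v / d)\<^sup>2 * d"
      unfolding quad[symmetric] by (rule psd)
    then show ?thesis using False by (simp add: power2_eq_square field_simps)
  qed (use psd in simp)
  ultimately have psd': "0 \<le> quad_form n X' v" for v by simp
  have "X' i j = 0" if "i < Suc k" "j < n" for i j
  proof (cases "i = k")
    case True
    then show ?thesis using row_zero that by (cases "d = 0") (auto simp: X'_def d_def)
  next
    case False
    then have "i < k" using that by simp
    then show ?thesis using zero that sym[of i k] kn by (simp add: X'_def)
  qed
  note zero' = this
  have sym': "X' i j = X' j i" if "i < n" "j < n" for i j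
    using sym[OF that] by (simp add: X'_def mult.commute)
  have "l = n - Suc k" "Suc k \<le> n" using Suc.hyps(2) kn by auto
  from Suc.hyps(1)[OF this sym' psd' zero']
  obtain x where x: "\<forall>i<n. \<forall>j<n. X' i j = (\<Sum>r\<in>{Suc k..<n}. x r i * x r j)"
    by blast
  define y where "y r = (if r = k then \<lambda>i. X k i / sqrt d else x r)" for r
  have "X i j = (\<Sum>r\<in>{k..<n}. y r i * y r j)" if "i < n" "j < n" for i j
  proof -
    have "(\<Sum>r\<in>{k..<n}. y r i * y r j) = y k i * y k j + (\<Sum>r\<in>{Suc k..<n}. y r i * y r j)"
      using kn by (simp add: sum.atLeast_Suc_lessThan)
    also have "(\<Sum>r\<in>{Suc k..<n}. y r i * y r j) = X' i j"
      using x that by (auto simp: y_def intro!: sum.cong)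
    also have "y k i * y k j = X k i * X k j / d"
      using d0 by (simp add: y_def)
    finally show ?thesis by (simp add: X'_def)
  qed
  then show ?case by blast
qed

lemma psd_gram:
  assumes "\<And>i j. i < n \<Longrightarrow> j < n \<Longrightarrow> X i j = X j i"
    and "\<And>v. 0 \<le> quad_form n X v"
  obtains x where "\<And>i j. i < n \<Longrightarrow> j < n \<Longrightarrow> X i j = (\<Sum>r<n. x r i * x r j)"
  using psd_gram_from[of 0 n X] assms by (auto simp: atLeast0LessThan)

section \<open>The dual certificate\<close>

lemma quad_form_eq_sum_mult: "quad_form n X v = (\<Sum>i<n. v i * (\<Sum>j<n. X i j * v j))"
  by (simp add: quad_form_def sum_distrib_left algebra_simps)

text \<open>By \<open>row\<close>, \<open>L\<close> annihilates block-constant vectors from the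
  right, and by symmetry from the left. Positive semidefiniteness of the dual slack thus needs
  checking on block-centred vectors only.\<close>

lemma quad_form_project:
  assumes "0 < m" and n: "n = m * K"
    and sym: "\<And>i j. i < n \<Longrightarrow> j < n \<Longrightarrow> L i j = L j i"
    and row: "\<And>i k. i < n \<Longrightarrow> k < K \<Longrightarrow> (\<Sum>j\<in>block m k. L i j) = 0"
  shows "quad_form n L (\<lambda>i. v i - w (i div m)) = quad_form n L v"
proof -
  define u where "u i = v i - w (i div m)" for i
  have zero: "(\<Sum>j<n. L i j * w (j div m)) = 0" if "i < n" for i
  proof -
    have "(\<Sum>j<n. L i j * w (j div m)) = (\<Sum>j<m * K. w (j div m) * L i j)"
      by (simp add: n mult.commute)
    also have "\<dots> = 0"
      unfolding sum_block_wise_mult[OF assms(1)] using row that by simp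
    finally show ?thesis .
  qed
  have apply_u: "(\<Sum>j<n. L i j * u j) = (\<Sum>j<n. L i j * v j)" if "i < n" for i
    using zero[OF that] by (simp add: u_def right_diff_distrib sum_subtractf)
  have "quad_form n L u = (\<Sum>i<n. u i * (\<Sum>j<n. L i j * v j))"
    unfolding quad_form_eq_sum_mult using apply_u by (intro sum.cong) auto
  also have "\<dots> = (\<Sum>i<n. \<Sum>j<n. u i * (L i j * v j))"
    by (simp add: sum_distrib_left)
  also have "\<dots> = (\<Sum>j<n. \<Sum>i<n. u i * (L i j * v j))"
    by (rule sum.swap)
  also have "\<dots> = (\<Sum>j<n. v j * (\<Sum>i<n. L j i * u i))"
    unfolding sum_distrib_left using sym by (intro sum.cong refl) (auto simp: mult_ac)
  also have "\<dots> = quad_form n L v"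
    unfolding quad_form_eq_sum_mult using apply_u by (intro sum.cong) auto
  finally show ?thesis by (simp add: u_def[abs_def])
qed

lemma block_centered_subtract_mean:
  assumes "0 < m"
  shows "block_centered m K (\<lambda>i. v i - (\<Sum>j\<in>block m (i div m). v j) / m)"
  unfolding block_centered_def
proof (intro allI impI)
  fix k
  show "(\<Sum>i\<in>block m k. v i - (\<Sum>j\<in>block m (i div m). v j) / m) = 0"
    using assms sum_block_const[OF assms, of "\<lambda>i l. v i - (\<Sum>j\<in>block m l. v j) / m" k]
    by (simp add: sum_subtractf) (simp add: block_def)
qed

lemma double_sum_eq_zeroD:
  fixes f :: "nat \<Rightarrow> nat \<Rightarrow> real"
  assumes "\<And>i j. i < n \<Longrightarrow> j < n \<Longrightarrow> 0 \<le> f i j" "(\<Sum>i<n. \<Sum>j<n. f i j) = 0" "i < n" "j < n"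
  shows "f i j = 0"
proof -
  have "(\<Sum>j<n. f i j) = 0"
    using assms by (subst (asm) sum_nonneg_eq_0_iff) (auto intro!: sum_nonneg)
  then show ?thesis
    using assms by (subst (asm) sum_nonneg_eq_0_iff) auto
qed

text \<open>\<open>L\<close> is the dual slack matrix, with \<open>\<epsilon>\<close> times the projection onto block-centred vectors
  subtracted; the parameter \<open>\<epsilon>\<close> gives uniqueness. On off-diagonal blocks \<open>L\<close> is minus the
  doubly centred block of \<open>b\<close>, so that it annihilates block-constant vectors; the multiplier of
  the constraint \<open>X \<ge> 0\<close> is what remains there, and \<open>cross\<close> makes it nonnegative.\<close>

lemma sdp_certificate:
  fixes b X :: "nat \<Rightarrow> nat \<Rightarrow> real"
  assumes m: "0 < m" and n: "n = m * K"
    and b_sym: "\<And>i j. i < n \<Longrightarrow> j < n \<Longrightarrow> b i j = b j i"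
    and deg: "\<And>i. i < n \<Longrightarrow> \<theta> + \<mu> * m < (\<Sum>j\<in>block m (i div m). b i j)"
    and cross: "\<And>i j. i < n \<Longrightarrow> j < n \<Longrightarrow> i div m \<noteq> j div m \<Longrightarrow>
      (\<Sum>j'\<in>block m (j div m). b i j') + (\<Sum>i'\<in>block m (i div m). b j i')
        - (\<Sum>i'\<in>block m (i div m). \<Sum>j'\<in>block m (j div m). b i' j') / m \<le> \<mu> * m"
    and noise: "\<And>u. block_centered m K u \<Longrightarrow> quad_form n b u \<le> \<theta> * (\<Sum>i<n. (u i)\<^sup>2)"
    and X_sym: "\<And>i j. i < n \<Longrightarrow> j < n \<Longrightarrow> X i j = X j i"
    and X_psd: "\<And>v. 0 \<le> quad_form n X v"
    and X_nonneg: "\<And>i j. i < n \<Longrightarrow> j < n \<Longrightarrow> 0 \<le> X i j"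
    and X_diag: "\<And>i. i < n \<Longrightarrow> X i i = 1"
    and X_sum: "(\<Sum>i<n. \<Sum>j<n. X i j) = n * m"
  shows "(\<Sum>i<n. \<Sum>j<n. b i j * X i j) \<le> (\<Sum>i<n. \<Sum>j\<in>block m (i div m). b i j)"
    and "(\<Sum>i<n. \<Sum>j<n. b i j * X i j) = (\<Sum>i<n. \<Sum>j\<in>block m (i div m). b i j) \<Longrightarrow>
      i < n \<Longrightarrow> j < n \<Longrightarrow> X i j = (if i div m = j div m then 1 else 0)"
proof -
  define R where "R i l = (\<Sum>j\<in>block m l. b i j)" for i l
  define T where "T k l = (\<Sum>i\<in>block m k. R i l)" for k l
  define d where "d i = R i (i div m)" for i
  have in_block: "i div m < K" if "i < n" for i
    using that n by (simp add: less_mult_imp_div_less mult.commute)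
  have block_lt: "i < n" if "i \<in> block m k" "k < K" for i k
    using block_less[OF that] n by simp
  have T_sym: "T k l = T l k" if "k < K" "l < K" for k l
    unfolding T_def R_def using block_lt that b_sym
    by (subst sum.swap) (intro sum.cong; auto)
  \<comment> \<open>A strict inequality at finitely many vertices leaves a uniform slack. The empty
    case is separate because a minimum over the empty set says nothing.\<close>
  obtain \<epsilon> where \<epsilon>: "0 < \<epsilon>" "\<And>i. i < n \<Longrightarrow> \<theta> + \<mu> * m + \<epsilon> \<le> d i"
  proof (cases "n = 0")
    case True then show ?thesis using that[of 1] by simp
  next
    case False
    define \<epsilon> where "\<epsilon> = Min ((\<lambda>i. d i - \<theta> - \<mu> * m) ` {..<n})"
    have "\<epsilon> \<le> d i - \<theta> - \<mu> * m" if "i < n" for i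
      unfolding \<epsilon>_def using that by (intro Min_le) auto
    moreover have "0 < \<epsilon>"
      unfolding \<epsilon>_def using False deg by (subst Min_gr_iff) (auto simp: d_def R_def less_diff_eq add.commute)
    ultimately show ?thesis using that[of \<epsilon>] by (simp add: algebra_simps)
  qed
  \<comment> \<open>The values are forced by zero row sums of \<open>L\<close> over every block.
    Inside a block the two \<open>h\<close> terms of \<open>L\<close> add up to
    \<open>\<mu> + \<epsilon> / m\<close>, which cancels the diagonal against the degree. Across
    blocks they restore the row mean and the column mean and remove the grand mean, half of it in
    each term.\<close>
  define h where "h i l = (if l = i div m then (\<mu> + \<epsilon> / m) / 2
      else R i l / m - T (i div m) l / (2 * m * m))" for i l
  define L where "L i j = (if i = j then d i - \<mu> * m - \<epsilon> else 0) - b i j + h i (j div m) + h j (i div m)" for i j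
  have L_sym: "L i j = L j i" if "i < n" "j < n" for i j
    using b_sym[OF that] by (simp add: L_def)
  have L_row: "(\<Sum>j\<in>block m k. L i j) = 0" if "i < n" "k < K" for i k
  proof -
    have "i \<in> block m k \<longleftrightarrow> i div m = k" using block_iff[OF m] by (simp add: block_def)
    then have "(\<Sum>j\<in>block m k. if i = j then d i - \<mu> * m - \<epsilon> else 0)
        = (if i div m = k then d i - \<mu> * m - \<epsilon> else 0)"
      by (simp add: block_def)
    moreover have "(\<Sum>j\<in>block m k. h i (j div m)) = m * h i k"
      using sum_block_const[OF m, of "\<lambda>_. h i" k] by (simp add: card_block)
    moreover have "(\<Sum>j\<in>block m k. h j (i div m)) =
      (if i div m = k then m * ((\<mu> + \<epsilon> / m) / 2) else T k (i div m) / m - T k (i div m) / (2 * m))"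
    proof -
      have "(\<Sum>j\<in>block m k. h j (i div m)) = (\<Sum>j\<in>block m k. if i div m = k then (\<mu> + \<epsilon> / m) / 2
          else R j (i div m) / m - T k (i div m) / (2 * m * m))"
        unfolding h_def using block_iff[OF m] by (intro sum.cong) (auto simp: block_def)
      then show ?thesis
        using m by (simp add: card_block sum_subtractf sum_divide_distrib[symmetric] T_def[symmetric])
    qed
    ultimately have "(\<Sum>j\<in>block m k. L i j) = (if i div m = k then d i - \<mu> * m - \<epsilon> else 0) - R i k + m * h i k
       + (if i div m = k then m * ((\<mu> + \<epsilon> / m) / 2) else T k (i div m) / m - T k (i div m) / (2 * m))"
      by (simp add: L_def sum.distrib sum_subtractf R_def)
    also have "\<dots> = 0"
    proof (cases "i div m = k")
      case True
      then show ?thesis using m by (simp add: h_def d_def field_simps)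
    next
      case False
      then show ?thesis
        using m T_sym[OF in_block[OF \<open>i < n\<close>] \<open>k < K\<close>] by (simp add: h_def field_simps)
    qed
    finally show ?thesis .
  qed
  \<comment> \<open>On the block-centred part \<open>u\<close> of \<open>v\<close> the
    \<open>h\<close> terms drop out, each being constant over blocks in one index. What remains is
    the diagonal \<open>d i - \<mu> * m - \<epsilon> \<ge> \<theta>\<close> against the noise
    bound.\<close>
  have L_psd: "0 \<le> quad_form n L v" for v
  proof -
    define u where "u i = v i - (\<Sum>j\<in>block m (i div m). v j) / m" for i
    have u: "block_centered m K u"
      unfolding u_def by (rule block_centered_subtract_mean[OF m])
    have h_zero: "(\<Sum>i<n. \<Sum>j<n. h i (j div m) * u i * u j) = 0"
    proof -
      have "(\<Sum>j<n. h i (j div m) * u i * u j) = 0" for i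
        using sum_block_wise_mult_centered[OF m u, of "\<lambda>l. h i l * u i"] by (simp add: n)
      then show ?thesis by simp
    qed
    have h_zero': "(\<Sum>i<n. \<Sum>j<n. h j (i div m) * u i * u j) = 0"
      using h_zero by (subst sum.swap) (simp add: mult_ac)
    have "0 \<le> (\<Sum>i<n. (d i - \<mu> * m - \<epsilon> - \<theta>) * (u i)\<^sup>2)"
      using \<epsilon>(2) by (intro sum_nonneg mult_nonneg_nonneg) (auto simp: algebra_simps)
    also have "\<dots> = (\<Sum>i<n. (d i - \<mu> * m - \<epsilon>) * (u i)\<^sup>2) - \<theta> * (\<Sum>i<n. (u i)\<^sup>2)"
      by (simp add: left_diff_distrib sum_subtractf sum_distrib_left)
    also have "\<dots> \<le> (\<Sum>i<n. (d i - \<mu> * m - \<epsilon>) * (u i)\<^sup>2) - quad_form n b u"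
      using noise[OF u] by simp
    also have "\<dots> = (\<Sum>i<n. \<Sum>j<n. (if i = j then d i - \<mu> * m - \<epsilon> else 0) * u i * u j) - quad_form n b u
       + (\<Sum>i<n. \<Sum>j<n. h i (j div m) * u i * u j) + (\<Sum>i<n. \<Sum>j<n. h j (i div m) * u i * u j)"
    proof -
      have "(\<Sum>j<n. (if i = j then d i - \<mu> * m - \<epsilon> else 0) * u i * u j) = (d i - \<mu> * m - \<epsilon>) * (u i)\<^sup>2"
        if "i < n" for i
      proof -
        have "(\<Sum>j<n. (if i = j then d i - \<mu> * m - \<epsilon> else 0) * u i * u j)
          = (\<Sum>j<n. if i = j then (d i - \<mu> * m - \<epsilon>) * (u i)\<^sup>2 else 0)"
          by (intro sum.cong) (auto simp: power2_eq_square)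
        then show ?thesis using that by simp
      qed
      then show ?thesis unfolding h_zero h_zero' by simp
    qed
    also have "\<dots> = quad_form n L u"
      unfolding quad_form_def L_def
      by (simp add: sum.distrib[symmetric] sum_subtractf[symmetric] algebra_simps)
    also have "\<dots> = quad_form n L v"
      unfolding u_def by (rule quad_form_project[OF m n L_sym L_row])
    finally show ?thesis .
  qed
  obtain x where x: "\<And>i j. i < n \<Longrightarrow> j < n \<Longrightarrow> X i j = (\<Sum>r<n. x r i * x r j)"
    using psd_gram[OF X_sym X_psd] by metis
  \<comment> \<open>Two positive semidefinite matrices have nonnegative inner product: a Gram
    factorization of \<open>X\<close> turns it into a sum of values of the quadratic form of
    \<open>L\<close>.\<close>
  have LX: "0 \<le> (\<Sum>i<n. \<Sum>j<n. L i j * X i j)"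
  proof -
    have "0 \<le> (\<Sum>r<n. quad_form n L (x r))"
      using L_psd by (intro sum_nonneg)
    also have "\<dots> = (\<Sum>i<n. \<Sum>r<n. \<Sum>j<n. L i j * x r i * x r j)"
      unfolding quad_form_def by (rule sum.swap)
    also have "\<dots> = (\<Sum>i<n. \<Sum>j<n. \<Sum>r<n. L i j * x r i * x r j)"
      by (intro sum.cong refl sum.swap)
    also have "\<dots> = (\<Sum>i<n. \<Sum>j<n. L i j * X i j)"
      using x by (intro sum.cong refl) (simp add: sum_distrib_left mult.assoc)
    finally show ?thesis .
  qed
  \<comment> \<open>The unit diagonal makes the Gram vectors unit vectors; their squared distance is
    \<open>2 - 2 * X i j\<close>.\<close>
  have X_le1: "X i j \<le> 1" if "i < n" "j < n" for i j
  proof -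
    have "0 \<le> (\<Sum>r<n. (x r i - x r j)\<^sup>2)" by (intro sum_nonneg) auto
    also have "\<dots> = X i i - 2 * X i j + X j j"
      using x that
      by (simp add: power2_diff sum.distrib sum_subtractf sum_distrib_left)
        (simp add: power2_eq_square mult.assoc)
    finally show ?thesis using X_diag that by simp
  qed
  define same where "same i j \<longleftrightarrow> i div m = j div m" for i j
  \<comment> \<open>The total mass of \<open>X\<close> equals the number of same-block pairs, so the
    mass missing inside the blocks is the mass lying outside them. A zero gap therefore determines
    \<open>X\<close> on both kinds of pairs.\<close>
  define gap where "gap = (\<Sum>i<n. \<Sum>j<n. if same i j then 1 - X i j else 0)"
  have count_same: "(\<Sum>i<n. \<Sum>j<n. if same i j then 1 else 0 :: real) = n * m"
    using sum_same_block[OF m, of _ K "\<lambda>_. 1"] by (simp add: same_def n card_block)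
  have gap_eq: "gap = n * m - (\<Sum>i<n. \<Sum>j<n. if same i j then X i j else 0)"
    unfolding gap_def count_same[symmetric] sum_subtractf[symmetric] by (intro sum.cong) auto
  \<comment> \<open>Across blocks, \<open>cross\<close> says that the two \<open>h\<close> terms are
    at most \<open>\<mu>\<close>, and \<open>X \<ge> 0\<close> preserves the inequality. Inside
    blocks the surplus \<open>\<epsilon> / m\<close> remains; it is what makes a positive gap cost
    objective value.\<close>
  have H_le: "(h i (j div m) + h j (i div m)) * X i j \<le> \<mu> * X i j + \<epsilon> / m * (if same i j then X i j else 0)"
    if "i < n" "j < n" for i j
  proof (cases "same i j")
    case True
    then show ?thesis by (simp add: h_def same_def algebra_simps add_divide_distrib)
  next
    case False
    then have ne: "i div m \<noteq> j div m" by (simp add: same_def)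
    have "h i (j div m) + h j (i div m) =
        (R i (j div m) + R j (i div m) - T (i div m) (j div m) / m) / m"
      using ne m T_sym[OF in_block[OF that(1)] in_block[OF that(2)]] by (simp add: h_def field_simps)
    also have "\<dots> \<le> \<mu>"
      using cross[OF that ne] m by (simp add: R_def T_def pos_divide_le_eq)
    finally show ?thesis using False X_nonneg[OF that] by (simp add: mult_right_mono)
  qed
  have "(\<Sum>i<n. \<Sum>j<n. b i j * X i j) = (\<Sum>i<n. \<Sum>j<n. (if i = j then d i - \<mu> * m - \<epsilon> else 0) * X i j)
      - (\<Sum>i<n. \<Sum>j<n. L i j * X i j) + (\<Sum>i<n. \<Sum>j<n. (h i (j div m) + h j (i div m)) * X i j)"
    unfolding L_def by (simp add: sum.distrib[symmetric] sum_subtractf[symmetric] algebra_simps)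
  also have "\<dots> \<le> (\<Sum>i<n. \<Sum>j<n. (if i = j then d i - \<mu> * m - \<epsilon> else 0) * X i j)
      + (\<Sum>i<n. \<Sum>j<n. \<mu> * X i j + \<epsilon> / m * (if same i j then X i j else 0))"
  proof -
    have "(\<Sum>i<n. \<Sum>j<n. (h i (j div m) + h j (i div m)) * X i j)
        \<le> (\<Sum>i<n. \<Sum>j<n. \<mu> * X i j + \<epsilon> / m * (if same i j then X i j else 0))"
      by (intro sum_mono H_le) auto
    then show ?thesis using LX by linarith
  qed
  also have "(\<Sum>i<n. \<Sum>j<n. (if i = j then d i - \<mu> * m - \<epsilon> else 0) * X i j) = (\<Sum>i<n. d i - \<mu> * m - \<epsilon>)"
  proof (intro sum.cong refl)
    fix i assume "i \<in> {..<n}"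
    then have "i < n" by simp
    have "(\<Sum>j<n. (if i = j then d i - \<mu> * m - \<epsilon> else 0) * X i j)
        = (\<Sum>j<n. if i = j then d i - \<mu> * m - \<epsilon> else 0)"
      using X_diag[OF \<open>i < n\<close>] by (intro sum.cong) auto
    then show "(\<Sum>j<n. (if i = j then d i - \<mu> * m - \<epsilon> else 0) * X i j) = d i - \<mu> * m - \<epsilon>"
      using \<open>i < n\<close> by simp
  qed
  also have "(\<Sum>i<n. \<Sum>j<n. \<mu> * X i j + \<epsilon> / m * (if same i j then X i j else 0))
      = \<mu> * (n * m) + \<epsilon> / m * (n * m - gap)"
    unfolding sum.distrib sum_distrib_left[symmetric] X_sum gap_eq by simp
  also have "(\<Sum>i<n. d i - \<mu> * m - \<epsilon>) + (\<mu> * (n * m) + \<epsilon> / m * (n * m - gap)) = (\<Sum>i<n. d i) - \<epsilon> / m * gap"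
    using m by (simp add: sum_subtractf field_simps)
  finally have main: "(\<Sum>i<n. \<Sum>j<n. b i j * X i j) \<le> (\<Sum>i<n. d i) - \<epsilon> / m * gap" .
  have gap_nonneg: "0 \<le> gap"
    unfolding gap_def using X_le1 by (intro sum_nonneg) auto
  then have "0 \<le> \<epsilon> / m * gap" using \<epsilon>(1) by simp
  with main show le: "(\<Sum>i<n. \<Sum>j<n. b i j * X i j) \<le> (\<Sum>i<n. \<Sum>j\<in>block m (i div m). b i j)"
    by (simp add: d_def R_def)
  assume eq: "(\<Sum>i<n. \<Sum>j<n. b i j * X i j) = (\<Sum>i<n. \<Sum>j\<in>block m (i div m). b i j)"
    and ij: "i < n" "j < n"
  have "\<epsilon> / m * gap \<le> 0" using main eq by (simp add: d_def R_def)
  then have "gap = 0" using \<epsilon>(1) m gap_nonneg by (simp add: mult_le_0_iff divide_le_0_iff)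
  then have "X i j = 1" if "same i j" "i < n" "j < n" for i j
    using double_sum_eq_zeroD[of n "\<lambda>i j. if same i j then 1 - X i j else 0" i j] X_le1 that
    by (simp add: gap_def)
  moreover have "(\<Sum>i<n. \<Sum>j<n. if same i j then 0 else X i j) = 0"
  proof -
    have "(\<Sum>i<n. \<Sum>j<n. if same i j then 0 else X i j)
       = (\<Sum>i<n. \<Sum>j<n. X i j) - (\<Sum>i<n. \<Sum>j<n. if same i j then X i j else 0)"
      unfolding sum_subtractf[symmetric] by (intro sum.cong) auto
    then show ?thesis using \<open>gap = 0\<close> gap_eq X_sum by simp
  qed
  then have "X i j = 0" if "\<not> same i j" "i < n" "j < n" for i j
    using double_sum_eq_zeroD[of n "\<lambda>i j. if same i j then 0 else X i j" i j] X_nonneg that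
    by simp
  ultimately show "X i j = (if i div m = j div m then 1 else 0)"
    using ij by (auto simp: same_def)
qed

section \<open>The semidefinite program in terms of matrix entries\<close>

lemma mat_inner_eq_sum:
  assumes "A \<in> carrier_mat n n" "X \<in> carrier_mat n n"
  shows "mat_inner A X = (\<Sum>i<n. \<Sum>j<n. A $$ (i, j) * X $$ (j, i))"
  using assms
  by (auto simp: mat_inner_def mat_trace_def times_mat_def scalar_prod_def atLeast0LessThan
      intro!: sum.cong)

lemma symmetric_matD:
  assumes "symmetric_mat A" "A \<in> carrier_mat n n" "i < n" "j < n"
  shows "A $$ (i, j) = A $$ (j, i)"
  using assms by (metis symmetric_mat_def carrier_matD index_transpose_mat(1))

lemma symmetric_matI:
  assumes "A \<in> carrier_mat n n" "\<And>i j. i < n \<Longrightarrow> j < n \<Longrightarrow> A $$ (i, j) = A $$ (j, i)"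
  shows "symmetric_mat A"
  unfolding symmetric_mat_def using assms by (intro eq_matI) auto

lemma scalar_prod_mult_mat_vec:
  assumes "X \<in> carrier_mat n n" "v \<in> carrier_vec n"
  shows "scalar_prod v (X *\<^sub>v v) = quad_form n (\<lambda>i j. X $$ (i, j)) (\<lambda>i. v $ i)"
  using assms
  by (auto simp: quad_form_eq_sum_mult scalar_prod_def atLeast0LessThan intro!: sum.cong)

lemma psd_mat_iff:
  assumes "X \<in> carrier_mat n n"
  shows "psd_mat X \<longleftrightarrow> symmetric_mat X \<and> (\<forall>v. 0 \<le> quad_form n (\<lambda>i j. X $$ (i, j)) v)"
proof -
  have "0 \<le> quad_form n (\<lambda>i j. X $$ (i, j)) v"
    if "\<forall>v\<in>carrier_vec (dim_col X). scalar_prod v (X *\<^sub>v v) \<ge> 0" for v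
  proof -
    have "0 \<le> quad_form n (\<lambda>i j. X $$ (i, j)) (\<lambda>i. Matrix.vec n v $ i)"
      using bspec[OF that, of "Matrix.vec n v"] assms
        scalar_prod_mult_mat_vec[OF assms, of "Matrix.vec n v"] by simp
    also have "\<dots> = quad_form n (\<lambda>i j. X $$ (i, j)) v"
      unfolding quad_form_def by (intro sum.cong) auto
    finally show ?thesis .
  qed
  then show ?thesis
    using assms scalar_prod_mult_mat_vec[OF assms] by (auto simp: psd_mat_def)
qed

lemma sdp2'_feasible_iff:
  assumes "n = m * K" "1 \<le> K" and X: "X \<in> carrier_mat n n"
  shows "sdp2'_feasible n K X \<longleftrightarrow> symmetric_mat X \<and>
    (\<Sum>i<n. \<Sum>j<n. X $$ (i, j)) = n * m \<and> (\<forall>i<n. X $$ (i, i) = 1) \<and>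
    (\<forall>v. 0 \<le> quad_form n (\<lambda>i j. X $$ (i, j)) v) \<and> (\<forall>i<n. \<forall>j<n. 0 \<le> X $$ (i, j))"
proof -
  have "mat_inner (all_ones_mat n) X = (\<Sum>i<n. \<Sum>j<n. X $$ (j, i))"
    using mat_inner_eq_sum[OF _ X, of "all_ones_mat n"] by (simp add: all_ones_mat_def)
  also have "\<dots> = (\<Sum>i<n. \<Sum>j<n. X $$ (i, j))" by (rule sum.swap)
  finally have inner: "mat_inner (all_ones_mat n) X = (\<Sum>i<n. \<Sum>j<n. X $$ (i, j))" .
  have "(real n)\<^sup>2 / real K = n * m"
    using assms by (simp add: power2_eq_square)
  then show ?thesis
    unfolding sdp2'_feasible_def inner psd_mat_iff[OF X] using X by auto
qed

lemma true_cluster_mat_carrier: "true_cluster_mat m K \<in> carrier_mat (m * K) (m * K)"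
  by (simp add: true_cluster_mat_def kronecker_def all_ones_mat_def mult.commute)

lemma true_cluster_mat_index:
  assumes "0 < m" "i < m * K" "j < m * K"
  shows "true_cluster_mat m K $$ (i, j) = (if i div m = j div m then 1 else 0)"
proof -
  have "i div m < K" "j div m < K"
    using assms by (simp_all add: less_mult_imp_div_less mult.commute)
  then show ?thesis
    using assms by (simp add: true_cluster_mat_def kronecker_def all_ones_mat_def mult.commute)
qed

lemma sum_true_cluster_mat:
  assumes "0 < m" "n = m * K"
  shows "(\<Sum>i<n. \<Sum>j<n. f i j * true_cluster_mat m K $$ (i, j)) = (\<Sum>i<n. \<Sum>j\<in>block m (i div m). f i j)"
proof (rule sum.cong[OF refl])
  fix i assume "i \<in> {..<n}"
  then have "(\<Sum>j<n. f i j * true_cluster_mat m K $$ (i, j)) = (\<Sum>j<n. if i div m = j div m then f i j else 0)"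
    using assms by (intro sum.cong) (auto simp: true_cluster_mat_index)
  also have "\<dots> = (\<Sum>j\<in>block m (i div m). f i j)"
    using sum_same_block[OF assms(1), of i K] \<open>i \<in> {..<n}\<close> assms by simp
  finally show "(\<Sum>j<n. f i j * true_cluster_mat m K $$ (i, j)) = (\<Sum>j\<in>block m (i div m). f i j)" .
qed

lemma true_cluster_mat_feasible:
  assumes "0 < m" "1 \<le> K" and n: "n = m * K"
  shows "sdp2'_feasible n K (true_cluster_mat m K)"
proof -
  let ?X = "true_cluster_mat m K"
  have X: "?X \<in> carrier_mat n n" using true_cluster_mat_carrier n by simp
  note index = true_cluster_mat_index[OF assms(1), of _ K, folded n]
  have "(\<Sum>i<n. \<Sum>j<n. ?X $$ (i, j)) = n * m"
    using sum_true_cluster_mat[OF assms(1) n, of "\<lambda>_ _. 1"] by (simp add: block_def)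
  moreover have "0 \<le> quad_form n (\<lambda>i j. ?X $$ (i, j)) v" for v
  proof -
    have "quad_form n (\<lambda>i j. ?X $$ (i, j)) v = (\<Sum>i<n. \<Sum>j\<in>block m (i div m). v i * v j)"
      unfolding sum_true_cluster_mat[OF assms(1) n, symmetric] quad_form_def by (simp add: mult_ac)
    also have "\<dots> = (\<Sum>i<m * K. (\<Sum>j\<in>block m (i div m). v j) * v i)"
      by (simp add: n sum_distrib_left mult.commute)
    also have "\<dots> = (\<Sum>k<K. (\<Sum>j\<in>block m k. v j) * (\<Sum>j\<in>block m k. v j))"
      by (rule sum_block_wise_mult[OF assms(1)])
    also have "\<dots> \<ge> 0" by (intro sum_nonneg) auto
    finally show ?thesis .
  qed
  ultimately show ?thesis
    using index X by (subst sdp2'_feasible_iff[OF n assms(2) X]) (auto intro!: symmetric_matI)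
qed

text \<open>The unit diagonal of \<open>Y\<close> makes the contribution of the diagonal of
  \<open>A\<close> independent of \<open>Y\<close>. Hence the certificate may be built for any
  convenient diagonal.\<close>

lemma mat_inner_offdiag:
  assumes A: "A \<in> carrier_mat n n" and Y: "sdp2'_feasible n K Y"
    and A_b: "\<And>i j. i < n \<Longrightarrow> j < n \<Longrightarrow> i \<noteq> j \<Longrightarrow> A $$ (i, j) = b i j"
  shows "mat_inner A Y = (\<Sum>i<n. \<Sum>j<n. b i j * Y $$ (i, j)) + (\<Sum>i<n. A $$ (i, i) - b i i)"
proof -
  have Y_carrier: "Y \<in> carrier_mat n n" and Y_diag: "\<And>i. i < n \<Longrightarrow> Y $$ (i, i) = 1"
    and Y_sym: "\<And>i j. i < n \<Longrightarrow> j < n \<Longrightarrow> Y $$ (j, i) = Y $$ (i, j)"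
    using Y symmetric_matD by (auto simp: sdp2'_feasible_def)
  have "A $$ (i, j) * Y $$ (j, i) = b i j * Y $$ (i, j) + (if i = j then A $$ (i, i) - b i i else 0)"
    if "i < n" "j < n" for i j
    using A_b[OF that] Y_sym[OF that] Y_diag[of i] that by (cases "i = j") auto
  then show ?thesis
    unfolding mat_inner_eq_sum[OF A Y_carrier] by (simp add: sum.distrib)
qed

lemma sdp2'_solution_cong_offdiag:
  assumes A: "A \<in> carrier_mat n n" and B: "B \<in> carrier_mat n n"
    and off: "\<And>i j. i < n \<Longrightarrow> j < n \<Longrightarrow> i \<noteq> j \<Longrightarrow> A $$ (i, j) = B $$ (i, j)"
  shows "sdp2'_solution n K A X \<longleftrightarrow> sdp2'_solution n K B X"
proof -
  have "mat_inner A Y = mat_inner B Y + (\<Sum>i<n. A $$ (i, i) - B $$ (i, i))"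
    if "sdp2'_feasible n K Y" for Y
    using mat_inner_offdiag[OF A that, of "\<lambda>i j. B $$ (i, j)"]
      mat_inner_offdiag[OF B that, of "\<lambda>i j. B $$ (i, j)"] off by simp
  then show ?thesis by (auto simp: sdp2'_solution_def)
qed

lemma sdp2'_unique_solution:
  fixes b :: "nat \<Rightarrow> nat \<Rightarrow> real"
  assumes m: "0 < m" and K: "1 \<le> K" and n: "n = m * K"
    and A: "A \<in> carrier_mat n n"
    and A_b: "\<And>i j. i < n \<Longrightarrow> j < n \<Longrightarrow> i \<noteq> j \<Longrightarrow> A $$ (i, j) = b i j"
    and b_sym: "\<And>i j. i < n \<Longrightarrow> j < n \<Longrightarrow> b i j = b j i"
    and deg: "\<And>i. i < n \<Longrightarrow> \<theta> + \<mu> * m < (\<Sum>j\<in>block m (i div m). b i j)"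
    and cross: "\<And>i j. i < n \<Longrightarrow> j < n \<Longrightarrow> i div m \<noteq> j div m \<Longrightarrow>
      (\<Sum>j'\<in>block m (j div m). b i j') + (\<Sum>i'\<in>block m (i div m). b j i')
        - (\<Sum>i'\<in>block m (i div m). \<Sum>j'\<in>block m (j div m). b i' j') / m \<le> \<mu> * m"
    and noise: "\<And>u. block_centered m K u \<Longrightarrow> quad_form n b u \<le> \<theta> * (\<Sum>i<n. (u i)\<^sup>2)"
  shows "{X. sdp2'_solution n K A X} = {true_cluster_mat m K}"
proof -
  let ?X0 = "true_cluster_mat m K"
  note X0 = true_cluster_mat_feasible[OF m K n]
  have value_eq: "mat_inner A Y = (\<Sum>i<n. \<Sum>j<n. b i j * Y $$ (i, j)) + (\<Sum>i<n. A $$ (i, i) - b i i)"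
    if "sdp2'_feasible n K Y" for Y
    by (rule mat_inner_offdiag[OF A that]) (use A_b in auto)
  have X0_value: "mat_inner A ?X0 = (\<Sum>i<n. \<Sum>j\<in>block m (i div m). b i j) + (\<Sum>i<n. A $$ (i, i) - b i i)"
    unfolding value_eq[OF X0] sum_true_cluster_mat[OF m n] ..
  have opt: "mat_inner A Y \<le> mat_inner A ?X0 \<and> (mat_inner A Y = mat_inner A ?X0 \<longrightarrow> Y = ?X0)"
    if Y: "sdp2'_feasible n K Y" for Y
  proof -
    have Y_carrier: "Y \<in> carrier_mat n n" using Y by (simp add: sdp2'_feasible_def)
    note Y' = Y[unfolded sdp2'_feasible_iff[OF n K Y_carrier]]
    have "Y = ?X0" if "(\<Sum>i<n. \<Sum>j<n. b i j * Y $$ (i, j)) = (\<Sum>i<n. \<Sum>j\<in>block m (i div m). b i j)"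
    proof (rule eq_matI)
      fix i j assume "i < dim_row ?X0" "j < dim_col ?X0"
      then have ij: "i < n" "j < n" using true_cluster_mat_carrier[of m K] n by auto
      have "Y $$ (i, j) = (if i div m = j div m then 1 else 0)"
        by (rule sdp_certificate(2)[OF m n b_sym deg cross noise _ _ _ _ _ that ij])
          (use Y' symmetric_matD[OF _ Y_carrier] in auto)
      then show "Y $$ (i, j) = ?X0 $$ (i, j)"
        using true_cluster_mat_index[OF m, of i K j] ij n by simp
    qed (use Y_carrier true_cluster_mat_carrier[of m K] n in auto)
    moreover have "(\<Sum>i<n. \<Sum>j<n. b i j * Y $$ (i, j)) \<le> (\<Sum>i<n. \<Sum>j\<in>block m (i div m). b i j)"
      by (rule sdp_certificate(1)[OF m n b_sym deg cross noise])
        (use Y' symmetric_matD[OF _ Y_carrier] in auto)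
    ultimately show ?thesis
      unfolding X0_value using value_eq[OF Y] by auto
  qed
  then show ?thesis
    using X0 by (auto simp: sdp2'_solution_def intro: antisym)
qed

section \<open>Sums of independent Bernoulli variables\<close>

lemma finite_set_Pi_pmf_bool:
  assumes "finite I"
  shows "finite (set_pmf (Pi_pmf I dflt (p :: 'a \<Rightarrow> bool pmf)))"
proof -
  have "set_pmf (Pi_pmf I dflt p) \<subseteq> PiE_dflt I dflt (\<lambda>_. UNIV)"
    using set_Pi_pmf_subset'[OF assms, of dflt p] by (auto simp: PiE_dflt_def)
  then show ?thesis
    by (rule finite_subset) (use assms in auto)
qed

text \<open>The product of \<open>1 - s + s\<^sup>2 / 2\<close> with the Taylor polynomial
  \<open>1 + s + s\<^sup>2 / 2 \<le> exp s\<close> is \<open>1 + s^4 / 4\<close>, hence at least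
  1.\<close>

lemma exp_minus_le_quadratic:
  fixes s :: real
  assumes "0 \<le> s"
  shows "exp (- s) \<le> 1 - s + s\<^sup>2 / 2"
proof -
  have "1 \<le> (1 - s + s\<^sup>2 / 2) * (1 + s + s\<^sup>2 / 2)"
    using assms by (simp add: algebra_simps power2_eq_square)
  also have "\<dots> \<le> (1 - s + s\<^sup>2 / 2) * exp s"
  proof (rule mult_left_mono)
    show "1 + s + s\<^sup>2 / 2 \<le> exp s" using exp_lower_Taylor_quadratic[OF assms] by simp
    have "0 \<le> (1 - s)\<^sup>2 + 1" by simp
    then show "0 \<le> 1 - s + s\<^sup>2 / 2" by (simp add: power2_diff)
  qed
  finally show ?thesis by (simp add: exp_minus field_simps)
qed

text \<open>A negative \<open>l\<close> gives lower tails.\<close>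

lemma bernoulli_sum_mgf_bound:
  fixes p :: "'a \<Rightarrow> real" and l c :: real
  assumes I: "finite I" "S \<subseteq> I" and p: "\<And>x. x \<in> I \<Longrightarrow> p x \<in> {0..1}"
  shows "measure_pmf.prob (Pi_pmf I False (\<lambda>x. bernoulli_pmf (p x)))
      {f. c \<le> l * (\<Sum>x\<in>S. of_bool (f x))} \<le> exp ((exp l - 1) * (\<Sum>x\<in>S. p x) - c)"
    (is "measure_pmf.prob ?P _ \<le> _")
proof -
  \<comment> \<open>The factor 1 outside \<open>S\<close> extends the product to all of
    \<open>I\<close>, the index set of the product law.\<close>
  define g where "g x b = (if x \<in> S then exp (l * of_bool b) else 1)" for x b
  have prod_g: "(\<Prod>x\<in>I. g x (f x)) = exp (l * (\<Sum>x\<in>S. of_bool (f x)))" for f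
  proof -
    have "(\<Prod>x\<in>I. g x (f x)) = (\<Prod>x\<in>S. exp (l * of_bool (f x)))"
      using I unfolding g_def by (subst prod.inter_restrict[symmetric]) (auto simp: Int_absorb1)
    also have "\<dots> = exp (l * (\<Sum>x\<in>S. of_bool (f x)))"
      using finite_subset[OF I(2,1)] by (subst sum_distrib_left, subst exp_sum) auto
    finally show ?thesis .
  qed
  have integrable: "integrable (measure_pmf ?P) (h :: _ \<Rightarrow> real)" for h
    by (intro integrable_measure_pmf_finite finite_set_Pi_pmf_bool I(1))
  have "measure_pmf.prob ?P {f. c \<le> l * (\<Sum>x\<in>S. of_bool (f x))}
      = measure_pmf.prob ?P {f \<in> space (measure_pmf ?P). exp c \<le> (\<Prod>x\<in>I. g x (f x))}"
    by (simp add: prod_g)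
  also have "\<dots> \<le> measure_pmf.expectation ?P (\<lambda>f. \<Prod>x\<in>I. g x (f x)) / exp c"
    by (rule integral_Markov_inequality_measure[where A = "{}"])
       (auto simp: integrable prod_g)
  also have "measure_pmf.expectation ?P (\<lambda>f. \<Prod>x\<in>I. g x (f x))
      = (\<Prod>x\<in>I. measure_pmf.expectation (bernoulli_pmf (p x)) (g x))"
    using I by (intro expectation_prod_Pi_pmf) (auto simp: g_def intro!: integrable_measure_pmf_finite)
  also have "\<dots> \<le> (\<Prod>x\<in>I. if x \<in> S then exp ((exp l - 1) * p x) else 1)"
  proof (rule prod_mono, intro conjI)
    fix x assume x: "x \<in> I"
    have e: "measure_pmf.expectation (bernoulli_pmf (p x)) (g x) = p x * g x True + (1 - p x) * g x False"
      using p[OF x] by simp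
    show "0 \<le> measure_pmf.expectation (bernoulli_pmf (p x)) (g x)"
      by (intro Bochner_Integration.integral_nonneg) (auto simp: g_def)
    have "1 + (exp l - 1) * p x \<le> exp ((exp l - 1) * p x)" by (rule exp_ge_add_one_self)
    then show "measure_pmf.expectation (bernoulli_pmf (p x)) (g x)
        \<le> (if x \<in> S then exp ((exp l - 1) * p x) else 1)"
      unfolding e by (auto simp: g_def algebra_simps)
  qed
  also have "\<dots> = (\<Prod>x\<in>S. exp ((exp l - 1) * p x))"
    using I by (subst prod.inter_restrict[symmetric]) (auto simp: Int_absorb1)
  also have "\<dots> = exp ((exp l - 1) * (\<Sum>x\<in>S. p x))"
    using finite_subset[OF I(2,1)] by (simp add: exp_sum sum_distrib_left)
  finally show ?thesis by (simp add: exp_diff divide_right_mono)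
qed

text \<open>Chernoff bound with the second-order estimate of \<open>exp (- s)\<close>;
  \<open>s = t / V\<close> minimises \<open>s\<^sup>2 * V / 2 - s * t\<close>, with minimum
  \<open>- x\<close>. The variance proxy \<open>V\<close> is kept apart from the mean so that a
  vertex degree, whose mean omits the vertex itself, can be treated with the rounder value
  \<open>p * m\<close>.\<close>

lemma bernoulli_sum_lower_tail:
  fixes p :: "'a \<Rightarrow> real"
  assumes I: "finite I" "S \<subseteq> I" and p: "\<And>x. x \<in> I \<Longrightarrow> p x \<in> {0..1}"
    and V: "(\<Sum>x\<in>S. p x) \<le> V" and x: "0 \<le> x"
  shows "measure_pmf.prob (Pi_pmf I False (\<lambda>x. bernoulli_pmf (p x)))
      {f. (\<Sum>x\<in>S. of_bool (f x)) < (\<Sum>x\<in>S. p x) - sqrt (2 * V * x)} \<le> exp (- x)"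
    (is "measure_pmf.prob ?P _ \<le> _")
proof -
  define \<nu> where "\<nu> = (\<Sum>x\<in>S. p x)"
  have \<nu>: "0 \<le> \<nu>" "\<nu> \<le> V"
    unfolding \<nu>_def using V p I(2) by (auto intro!: sum_nonneg)
  show ?thesis
  proof (cases "V = 0")
    case True
    then have "{f. (\<Sum>x\<in>S. of_bool (f x)) < \<nu> - sqrt (2 * V * x)} = {}"
      using \<nu> by (auto simp: not_less intro: sum_nonneg)
    then show ?thesis unfolding \<nu>_def by simp
  next
    case False
    then have V_pos: "0 < V" using \<nu> by simp
    define t where "t = sqrt (2 * V * x)"
    define s where "s = t / V"
    have t: "0 \<le> t" "t\<^sup>2 = 2 * V * x" using V_pos x by (simp_all add: t_def)
    have s: "0 \<le> s" using t V_pos by (simp add: s_def)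
    have "measure_pmf.prob ?P {f. (\<Sum>x\<in>S. of_bool (f x)) < \<nu> - t}
      \<le> measure_pmf.prob ?P {f. - s * (\<nu> - t) \<le> - s * (\<Sum>x\<in>S. of_bool (f x))}"
      using s by (intro measure_pmf.finite_measure_mono) (auto intro: mult_left_mono)
    also have "\<dots> \<le> exp ((exp (- s) - 1) * \<nu> - (- s * (\<nu> - t)))"
      unfolding \<nu>_def by (rule bernoulli_sum_mgf_bound[OF I p])
    also have "\<dots> \<le> exp (- x)"
    proof -
      have "(exp (- s) - 1) * \<nu> \<le> (- s + s\<^sup>2 / 2) * \<nu>"
        using exp_minus_le_quadratic[OF s] \<nu>(1) by (intro mult_right_mono) auto
      moreover have "s\<^sup>2 / 2 * \<nu> \<le> s\<^sup>2 / 2 * V" using \<nu>(2) by (intro mult_left_mono) auto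
      moreover have "s\<^sup>2 / 2 * V - s * t = - (t\<^sup>2 / (2 * V))"
        using V_pos by (simp add: s_def power2_eq_square field_simps)
      moreover have "t\<^sup>2 / (2 * V) = x" using V_pos by (simp add: t(2))
      ultimately show ?thesis by (simp add: algebra_simps)
    qed
    finally show ?thesis unfolding \<nu>_def t_def .
  qed
qed

text \<open>A Bernstein-type bound from \<open>exp l - 1 \<le> l + l\<^sup>2\<close> on the unit
  interval. The summand \<open>x\<close> in the deviation covers sparse sums, whose upper tail is
  not Gaussian.\<close>

lemma bernoulli_sum_upper_tail:
  fixes p :: "'a \<Rightarrow> real"
  assumes I: "finite I" "S \<subseteq> I" and p: "\<And>x. x \<in> I \<Longrightarrow> p x \<in> {0..1}"
    and \<nu>: "(\<Sum>x\<in>S. p x) \<le> \<nu>" and x: "0 \<le> x"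
  shows "measure_pmf.prob (Pi_pmf I False (\<lambda>x. bernoulli_pmf (p x)))
      {f. \<nu> + (2 * sqrt (\<nu> * x) + x) \<le> (\<Sum>x\<in>S. of_bool (f x))} \<le> exp (- x)"
proof -
  define t where "t = 2 * sqrt (\<nu> * x) + x"
  have "0 \<le> (\<Sum>x\<in>S. p x)" using p I(2) by (auto intro!: sum_nonneg)
  with \<nu> have \<nu>0: "0 \<le> \<nu>" by simp
  \<comment> \<open>The balancing choice is \<open>sqrt (x / \<nu>)\<close>; it is admissible only
    up to 1. Beyond that, \<open>l = 1\<close> suffices because
    \<open>\<nu> \<le> sqrt (\<nu> * x)\<close>.\<close>
  obtain l where l: "0 \<le> l" "l \<le> 1" "\<nu> * l\<^sup>2 - l * t \<le> - x"
  proof (cases "x \<le> \<nu> \<and> 0 < \<nu>")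
    case True
    define l where "l = sqrt (x / \<nu>)"
    have "\<nu> * l\<^sup>2 = x" "l * sqrt (\<nu> * x) = x"
      using True x by (auto simp: l_def real_sqrt_mult[symmetric])
    moreover have "0 \<le> l * x" using x True by (simp add: l_def)
    ultimately have "\<nu> * l\<^sup>2 - l * t \<le> - x" by (simp add: t_def algebra_simps)
    then show ?thesis using that[of l] True x by (simp add: l_def)
  next
    case False
    then have "\<nu> \<le> x" using \<nu>0 x by auto
    then have "\<nu> \<le> sqrt (\<nu> * x)"
      using \<nu>0 by (intro real_le_rsqrt) (auto simp: power2_eq_square intro: mult_left_mono)
    then show ?thesis using that[of 1] \<nu>0 by (simp add: t_def)
  qed
  have "measure_pmf.prob (Pi_pmf I False (\<lambda>x. bernoulli_pmf (p x)))
      {f. \<nu> + t \<le> (\<Sum>x\<in>S. of_bool (f x))}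
    \<le> measure_pmf.prob (Pi_pmf I False (\<lambda>x. bernoulli_pmf (p x)))
      {f. l * (\<nu> + t) \<le> l * (\<Sum>x\<in>S. of_bool (f x))}"
    using l(1) by (intro measure_pmf.finite_measure_mono) (auto intro: mult_left_mono)
  also have "\<dots> \<le> exp ((exp l - 1) * (\<Sum>x\<in>S. p x) - l * (\<nu> + t))"
    by (rule bernoulli_sum_mgf_bound[OF I p])
  also have "\<dots> \<le> exp (- x)"
  proof -
    have "(exp l - 1) * (\<Sum>x\<in>S. p x) \<le> (exp l - 1) * \<nu>"
      using l(1) \<nu> by (intro mult_left_mono) auto
    also have "\<dots> \<le> (l + l\<^sup>2) * \<nu>"
      using exp_bound[OF l(1,2)] \<nu>0 by (intro mult_right_mono) auto
    finally show ?thesis using l(3) by (simp add: algebra_simps)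
  qed
  finally show ?thesis by (simp add: t_def)
qed

text \<open>Only finitely many configurations occur, each an intersection of independent events with
  the product probability. Every event about the configuration is a finite disjoint union of these,
  so \<open>\<Phi>\<close> may be arbitrary; in particular it may speak about the solution set of
  the program.\<close>

lemma (in prob_space) binary_config_transfer:
  fixes X :: "'i \<Rightarrow> 'a \<Rightarrow> real"
  assumes I: "finite I" and indep: "indep_vars (\<lambda>_. borel) X I"
    and binary: "\<And>i \<omega>. i \<in> I \<Longrightarrow> \<omega> \<in> space M \<Longrightarrow> X i \<omega> \<in> {0, 1}"
    and mean: "\<And>i. i \<in> I \<Longrightarrow> expectation (X i) = p i"
  defines "config \<equiv> \<lambda>\<omega> i. i \<in> I \<and> X i \<omega> = 1"
  shows "prob {\<omega> \<in> space M. \<Phi> (config \<omega>)}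
    = measure_pmf.prob (Pi_pmf I False (\<lambda>i. bernoulli_pmf (p i))) {f. \<Phi> f}"
proof -
  let ?P = "Pi_pmf I False (\<lambda>i. bernoulli_pmf (p i))"
  define F where "F = {f :: 'i \<Rightarrow> bool. \<forall>i. i \<notin> I \<longrightarrow> f i = False}"
  have rv: "X i \<in> borel_measurable M" if "i \<in> I" for i
    using indep that by (auto simp: indep_vars_def)
  have ev: "X i -` {c} \<inter> space M \<in> events" if "i \<in> I" for i c
    using rv[OF that] by (rule measurable_sets) auto
  have p_one: "prob (X i -` {1} \<inter> space M) = p i" if "i \<in> I" for i
  proof -
    have "expectation (X i) = expectation (indicator (X i -` {1} \<inter> space M))"
      using binary[OF that] by (intro Bochner_Integration.integral_cong) (auto simp: indicator_def)
    then show ?thesis using mean[OF that] ev[OF that] by simp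
  qed
  have p_zero: "prob (X i -` {0} \<inter> space M) = 1 - p i" if "i \<in> I" for i
  proof -
    have "X i -` {0} \<inter> space M = space M - (X i -` {1} \<inter> space M)"
      using binary[OF that] by auto
    then show ?thesis using prob_compl[OF ev[OF that]] p_one[OF that] by simp
  qed
  have p01: "0 \<le> p i" "p i \<le> 1" if "i \<in> I" for i
    using p_one[OF that] by (metis measure_nonneg, metis prob_le_1)
  have single: "{\<omega> \<in> space M. config \<omega> = f} \<in> events
      \<and> prob {\<omega> \<in> space M. config \<omega> = f} = pmf ?P f" if "f \<in> F" for f
  \<comment> \<open>An intersection over the empty index set is the universe rather than
    \<open>space M\<close>, so the description of atoms as intersections starts with nonempty
    \<open>I\<close>.\<close>
  proof (cases "I = {}")
    case True
    then have "f = (\<lambda>_. False)" "config = (\<lambda>_ _. False)"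
      using that by (auto simp: F_def config_def)
    then show ?thesis using True by (simp add: prob_space)
  next
    case False
    have eq: "{\<omega> \<in> space M. config \<omega> = f} = (\<Inter>i\<in>I. X i -` {of_bool (f i)} \<inter> space M)"
    proof (intro equalityI subsetI)
      fix \<omega> assume "\<omega> \<in> {\<omega> \<in> space M. config \<omega> = f}"
      then have \<omega>: "\<omega> \<in> space M" and f: "f = config \<omega>" by auto
      have "X i \<omega> = of_bool (f i)" if "i \<in> I" for i
        unfolding f using binary[OF that \<omega>] that by (auto simp: config_def)
      then show "\<omega> \<in> (\<Inter>i\<in>I. X i -` {of_bool (f i)} \<inter> space M)" using \<omega> by auto
    next
      fix \<omega> assume \<omega>: "\<omega> \<in> (\<Inter>i\<in>I. X i -` {of_bool (f i)} \<inter> space M)"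
      then have "\<omega> \<in> space M" using False by auto
      moreover have "X i \<omega> = of_bool (f i)" if "i \<in> I" for i
        using \<omega> that by blast
      then have "config \<omega> i = f i" for i
        using \<open>f \<in> F\<close> by (cases "i \<in> I") (auto simp: config_def F_def)
      ultimately show "\<omega> \<in> {\<omega> \<in> space M. config \<omega> = f}" by auto
    qed
    have "prob {\<omega> \<in> space M. config \<omega> = f} = (\<Prod>i\<in>I. prob (X i -` {of_bool (f i)} \<inter> space M))"
      unfolding eq by (rule indep_varsD_finite[OF indep False I]) auto
    also have "\<dots> = (\<Prod>i\<in>I. pmf (bernoulli_pmf (p i)) (f i))"
      using p_one p_zero p01 by (intro prod.cong refl) (case_tac "f x"; simp)
    also have "\<dots> = pmf ?P f"
      using that by (subst pmf_Pi'[OF I]) (auto simp: F_def)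
    finally show ?thesis
      using sets.finite_INT[OF I False ev, of "\<lambda>i. i" "\<lambda>i. of_bool (f i)"] unfolding eq by simp
  qed
  have F: "finite F"
  proof -
    have "F = PiE_dflt I False (\<lambda>_. UNIV)" by (auto simp: F_def PiE_dflt_def)
    then show ?thesis using I by auto
  qed
  have "{\<omega> \<in> space M. \<Phi> (config \<omega>)} = (\<Union>f\<in>{f \<in> F. \<Phi> f}. {\<omega> \<in> space M. config \<omega> = f})"
    by (auto simp: F_def config_def)
  then have "prob {\<omega> \<in> space M. \<Phi> (config \<omega>)} = (\<Sum>f\<in>{f \<in> F. \<Phi> f}. pmf ?P f)"
    using single F by (simp add: finite_measure_finite_Union[symmetric] image_subset_iff
        disjoint_family_on_def) (subst finite_measure_finite_Union, auto simp: disjoint_family_on_def)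
  also have "\<dots> = measure_pmf.prob ?P {f \<in> F. \<Phi> f}"
    using F by (simp add: measure_measure_pmf_finite)
  also have "\<dots> = measure_pmf.prob ?P {f. \<Phi> f}"
    using set_Pi_pmf_subset[OF I, of False "\<lambda>i. bernoulli_pmf (p i)"]
    by (intro measure_prob_cong_0) (auto simp: F_def set_pmf_eq)
  finally show ?thesis .
qed

section \<open>Spectral noise\<close>

text \<open>Each \<open>X j\<close> reads, through \<open>g\<close>, the single coordinate
  \<open>h j\<close>, and injectivity of \<open>h\<close> keeps these coordinates distinct;
  independence of the coordinates of the product law carries over.\<close>

lemma indep_vars_map_Pi_pmf:
  fixes X :: "'j \<Rightarrow> 'c \<Rightarrow> real"
  assumes I: "finite I" and h: "inj_on h J" "h ` J \<subseteq> I"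
    and X: "\<And>j f. j \<in> J \<Longrightarrow> X j (g f) = Y j (f (h j))"
  shows "prob_space.indep_vars (measure_pmf (map_pmf g (Pi_pmf I d p))) (\<lambda>_. borel) X J"
proof -
  let ?P = "Pi_pmf I d p"
  have "measure_pmf.prob (map_pmf g ?P) (\<Inter>j\<in>K. A j)
      = (\<Prod>j\<in>K. measure_pmf.prob (map_pmf g ?P) (A j))"
    if K: "K \<subseteq> J" "K \<noteq> {}" "finite K" and A: "\<forall>j\<in>K. \<exists>B. A j = X j -` B" for K A
  proof -
    obtain B where B: "\<And>j. j \<in> K \<Longrightarrow> A j = X j -` B j" using A by metis
    have inj: "inj_on h K" using h(1) K(1) by (rule inj_on_subset)
    define S where "S e = Y (the_inv_into K h e) -` B (the_inv_into K h e)" for e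
    have S: "g -` A j = (\<lambda>f. f (h j)) -` S (h j)" if "j \<in> K" for j
      using X[of j] K(1) that the_inv_into_f_f[OF inj that] by (auto simp: B S_def)
    have "measure_pmf.prob (map_pmf g ?P) (\<Inter>j\<in>K. A j)
        = measure_pmf.prob ?P (\<Inter>e\<in>h ` K. (\<lambda>f. f e) -` S e \<inter> space (measure_pmf ?P))"
      using S K(2) by (auto simp: vimage_INT intro!: arg_cong[where f = "measure_pmf.prob ?P"])
    also have "\<dots> = (\<Prod>e\<in>h ` K. measure_pmf.prob ?P ((\<lambda>f. f e) -` S e \<inter> space (measure_pmf ?P)))"
      using K h by (intro prob_space.indep_varsD[OF measure_pmf.prob_space_axioms indep_vars_Pi_pmf[OF I]]) auto
    also have "\<dots> = (\<Prod>j\<in>K. measure_pmf.prob (map_pmf g ?P) (A j))"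
      using S by (simp add: prod.reindex[OF inj])
    finally show ?thesis .
  qed
  note factor = this
  show ?thesis
    unfolding prob_space.indep_vars_def2[OF measure_pmf.prob_space_axioms]
      prob_space.indep_sets_def[OF measure_pmf.prob_space_axioms]
  proof (intro conjI ballI allI impI)
    fix K A
    assume "K \<subseteq> J" "K \<noteq> {}" "finite K"
      and A: "A \<in> (\<Pi> j\<in>K. {X j -` B \<inter> space (measure_pmf (map_pmf g ?P)) |B. B \<in> sets borel})"
    then show "measure_pmf.prob (map_pmf g ?P) (\<Inter>j\<in>K. A j)
      = (\<Prod>j\<in>K. measure_pmf.prob (map_pmf g ?P) (A j))"
      by (intro factor) (fastforce simp: Pi_iff)+
  qed auto
qed

section \<open>Operator norm and quadratic forms\<close>

lemma euclidean_norm_eq_sum: "euclidean_norm v = sqrt (\<Sum>i<dim_vec v. (v $ i)\<^sup>2)"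
  by (simp add: euclidean_norm_def scalar_prod_def atLeast0LessThan power2_eq_square)

lemma euclidean_norm_smult: "euclidean_norm (a \<cdot>\<^sub>v v) = \<bar>a\<bar> * euclidean_norm v"
  by (simp add: euclidean_norm_eq_sum power_mult_distrib sum_distrib_left[symmetric] real_sqrt_mult)

text \<open>A crude bound that makes the set in the definition of \<open>operator_norm\<close>
  bounded above, so that the real supremum really dominates its members.\<close>

lemma euclidean_norm_mult_le_frobenius:
  assumes B: "B \<in> carrier_mat n n" and v: "v \<in> carrier_vec n"
  shows "euclidean_norm (B *\<^sub>v v) \<le> sqrt (\<Sum>i<n. \<Sum>j<n. (B $$ (i, j))\<^sup>2) * euclidean_norm v"
proof -
  have entry: "(B *\<^sub>v v) $ i = (\<Sum>j<n. B $$ (i, j) * v $ j)" if "i < n" for i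
    using that B v by (simp add: scalar_prod_def atLeast0LessThan)
  have "(\<Sum>i<n. ((B *\<^sub>v v) $ i)\<^sup>2) \<le> (\<Sum>i<n. (\<Sum>j<n. (B $$ (i, j))\<^sup>2) * (\<Sum>j<n. (v $ j)\<^sup>2))"
    by (intro sum_mono) (simp add: entry Cauchy_Schwarz_ineq_sum)
  then show ?thesis
    using B v by (simp add: euclidean_norm_eq_sum real_sqrt_mult[symmetric] sum_distrib_right[symmetric])
qed

lemma euclidean_norm_mult_le:
  assumes B: "B \<in> carrier_mat n n" and v: "v \<in> carrier_vec n"
  shows "euclidean_norm (B *\<^sub>v v) \<le> operator_norm B * euclidean_norm v"
proof (cases "euclidean_norm v = 0")
  case True
  then show ?thesis using euclidean_norm_mult_le_frobenius[OF B v] by simp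
next
  case False
  then have pos: "0 < euclidean_norm v"
    by (auto simp: euclidean_norm_eq_sum intro!: sum_nonneg order.not_eq_order_implies_strict)
  define w where "w = (1 / euclidean_norm v) \<cdot>\<^sub>v v"
  have w: "w \<in> carrier_vec n" "euclidean_norm w = 1"
    using v pos by (simp_all add: w_def euclidean_norm_smult)
  have "bdd_above ((\<lambda>v. euclidean_norm (B *\<^sub>v v)) ` {v \<in> carrier_vec (dim_col B). euclidean_norm v \<le> 1})"
  proof (rule bdd_aboveI2)
    fix x assume "x \<in> {v \<in> carrier_vec (dim_col B). euclidean_norm v \<le> 1}"
    then have x: "x \<in> carrier_vec n" "euclidean_norm x \<le> 1" using B by auto
    have "euclidean_norm (B *\<^sub>v x) \<le> sqrt (\<Sum>i<n. \<Sum>j<n. (B $$ (i, j))\<^sup>2) * euclidean_norm x"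
      by (rule euclidean_norm_mult_le_frobenius[OF B x(1)])
    also have "\<dots> \<le> sqrt (\<Sum>i<n. \<Sum>j<n. (B $$ (i, j))\<^sup>2) * 1"
      using x(2) by (intro mult_left_mono) (auto intro!: sum_nonneg)
    finally show "euclidean_norm (B *\<^sub>v x) \<le> sqrt (\<Sum>i<n. \<Sum>j<n. (B $$ (i, j))\<^sup>2)" by simp
  qed
  then have "euclidean_norm (B *\<^sub>v w) \<le> operator_norm B"
    unfolding operator_norm_def using w B by (intro cSUP_upper) auto
  moreover have "B *\<^sub>v w = (1 / euclidean_norm v) \<cdot>\<^sub>v (B *\<^sub>v v)"
    unfolding w_def using B v by (simp add: mult_mat_vec)
  ultimately show ?thesis using pos by (simp add: euclidean_norm_smult pos_divide_le_eq)
qed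

lemma quad_form_le_operator_norm:
  assumes B: "B \<in> carrier_mat n n"
  shows "quad_form n (\<lambda>i j. B $$ (i, j)) u \<le> operator_norm B * (\<Sum>i<n. (u i)\<^sup>2)"
proof -
  define v where "v = Matrix.vec n u"
  have v: "v \<in> carrier_vec n" by (simp add: v_def)
  have norm_v: "euclidean_norm v = sqrt (\<Sum>i<n. (u i)\<^sup>2)"
    by (simp add: euclidean_norm_eq_sum v_def)
  have "quad_form n (\<lambda>i j. B $$ (i, j)) u = (\<Sum>i<n. u i * (B *\<^sub>v v) $ i)"
    using B by (auto simp: quad_form_def v_def scalar_prod_def atLeast0LessThan sum_distrib_left mult_ac
        intro!: sum.cong)
  also have "\<dots> \<le> sqrt ((\<Sum>i<n. (u i)\<^sup>2) * (\<Sum>i<n. ((B *\<^sub>v v) $ i)\<^sup>2))"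
    by (intro real_le_rsqrt Cauchy_Schwarz_ineq_sum)
  also have "\<dots> = euclidean_norm v * euclidean_norm (B *\<^sub>v v)"
    using B by (simp add: norm_v real_sqrt_mult) (simp add: euclidean_norm_eq_sum)
  also have "\<dots> \<le> euclidean_norm v * (operator_norm B * euclidean_norm v)"
    by (intro mult_left_mono euclidean_norm_mult_le[OF B v]) (simp add: norm_v sum_nonneg)
  also have "\<dots> = operator_norm B * (\<Sum>i<n. (u i)\<^sup>2)"
    by (simp add: norm_v sum_nonneg mult.left_commute flip: real_sqrt_mult)
  finally show ?thesis .
qed

section \<open>The random graph as a product law on edges\<close>

definition edge_law :: "nat \<Rightarrow> (nat \<times> nat \<Rightarrow> real) \<Rightarrow> (nat \<times> nat \<Rightarrow> bool) pmf" where
  "edge_law n \<pi> = Pi_pmf {(i, j). i < j \<and> j < n} False (\<lambda>e. bernoulli_pmf (\<pi> e))"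

definition edge :: "nat \<Rightarrow> nat \<Rightarrow> nat \<times> nat" where
  "edge i j = (min i j, max i j)"

lemma edge_commute: "edge i j = edge j i"
  by (simp add: edge_def min.commute max.commute)

lemma finite_pairs: "finite {(i :: nat, j). i < j \<and> j < n}"
  by (rule finite_subset[of _ "{..<n} \<times> {..<n}"]) auto

lemma map_edge_law:
  assumes "i < n" "j < n" "i \<noteq> j"
  shows "map_pmf (\<lambda>f. f (edge i j)) (edge_law n \<pi>) = bernoulli_pmf (\<pi> (edge i j))"
proof -
  have "edge i j \<in> {(i, j). i < j \<and> j < n}"
    using assms by (auto simp: edge_def)
  then show ?thesis
    unfolding edge_law_def by (subst Pi_pmf_component[OF finite_pairs]) auto
qed

text \<open>The offset \<open>s\<close> and the selector \<open>W\<close> let one statement serve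
  both noise parts: a diagonal block is \<open>s = k * m\<close>, \<open>N = m\<close> with every
  pair selected, the rest is \<open>s = 0\<close>, \<open>N = n\<close> with pairs from different
  blocks selected. Deselected entries are constantly 0, so the matrix still has a symmetric 0-1 law
  with zero diagonal. The free \<open>\<sigma>\<close> may exceed the true standard
  deviation.\<close>

lemma edge_law_concentration:
  fixes \<pi> :: "nat \<times> nat \<Rightarrow> real"
  assumes const: "concentration_constants C C' c r"
    and N: "1 \<le> N" "s + N \<le> n"
    and W_sym: "\<And>i j. W i j \<Longrightarrow> W j i"
    and \<pi>: "\<And>e. \<pi> e \<in> {0..1}"
    and var: "\<And>i j. i < N \<Longrightarrow> j < N \<Longrightarrow> i \<noteq> j \<Longrightarrow> W i j \<Longrightarrow> \<pi> (edge (s + i) (s + j)) \<le> \<sigma>\<^sup>2"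
    and \<sigma>: "0 \<le> \<sigma>" "C' * ln N \<le> N * \<sigma>\<^sup>2"
  shows "1 - c * N powr (- r) \<le> measure_pmf.prob (edge_law n \<pi>)
    {f. \<forall>u. quad_form N (\<lambda>i j. if i \<noteq> j \<and> W i j
          then of_bool (f (edge (s + i) (s + j))) - \<pi> (edge (s + i) (s + j)) else 0) u
        \<le> C * \<sigma> * sqrt N * (\<Sum>i<N. (u i)\<^sup>2)}"
proof -
  define adj :: "(nat \<times> nat \<Rightarrow> bool) \<Rightarrow> real mat" where
    "adj f = Matrix.mat N N (\<lambda>(i, j). of_bool (i \<noteq> j \<and> W i j \<and> f (edge (s + i) (s + j))))" for f
  define D where "D = map_pmf adj (edge_law n \<pi>)"
  have law: "symmetric_01_law N D"
    unfolding symmetric_01_law_def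
  proof (intro conjI ballI)
    fix B assume "B \<in> set_pmf D"
    then obtain f where "B = adj f" by (auto simp: D_def)
    then show "B \<in> carrier_mat N N" "symmetric_mat B" "\<forall>i<N. \<forall>j<N. B $$ (i, j) \<in> {0, 1}"
      "\<forall>i<N. B $$ (i, i) = 0"
      using W_sym by (auto simp: adj_def edge_commute intro!: symmetric_matI)
  next
    show "prob_space.indep_vars (measure_pmf D) (\<lambda>_. borel) (\<lambda>(i, j) B. B $$ (i, j)) {(i, j). j < i \<and> i < N}"
      unfolding D_def edge_law_def
    proof (rule indep_vars_map_Pi_pmf[OF finite_pairs])
      \<comment> \<open>The concentration property takes independence over the lower triangle, while
        an edge is stored with its smaller vertex first; hence the swap.\<close>
      show "inj_on (\<lambda>(i, j). (s + j, s + i)) {(i, j). j < i \<and> i < N}"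
        by (auto simp: inj_on_def)
      show "(\<lambda>(i, j). (s + j, s + i)) ` {(i, j). j < i \<and> i < N} \<subseteq> {(i, j). i < j \<and> j < n}"
        using N by auto
      show "(case x of (i, j) \<Rightarrow> \<lambda>B. B $$ (i, j)) (adj f)
          = (\<lambda>(i, j) b. of_bool (W i j \<and> b)) x (f ((\<lambda>(i, j). (s + j, s + i)) x))"
        if "x \<in> {(i, j). j < i \<and> i < N}" for x f
        using that by (auto simp: adj_def edge_def)
    qed
  qed
  have entry: "map_pmf (\<lambda>B. B $$ (i, j)) D = (if i \<noteq> j \<and> W i j
      then map_pmf of_bool (bernoulli_pmf (\<pi> (edge (s + i) (s + j)))) else return_pmf 0)"
    if "i < N" "j < N" for i j
  proof (cases "i \<noteq> j \<and> W i j")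
    case True
    have "map_pmf (\<lambda>B. B $$ (i, j)) D = map_pmf of_bool (map_pmf (\<lambda>f. f (edge (s + i) (s + j))) (edge_law n \<pi>))"
      unfolding D_def map_pmf_comp using that True by (intro map_pmf_cong) (auto simp: adj_def)
    then show ?thesis using True that N by (subst (asm) map_edge_law) auto
  next
    case False
    then have "map_pmf (\<lambda>B. B $$ (i, j)) D = map_pmf (\<lambda>_. 0) (edge_law n \<pi>)"
      unfolding D_def map_pmf_comp using that by (intro map_pmf_cong) (auto simp: adj_def)
    then show ?thesis using False by auto
  qed
  have E: "measure_pmf.expectation D (\<lambda>B. \<phi> (B $$ (i, j))) = (if i \<noteq> j \<and> W i j
      then \<pi> (edge (s + i) (s + j)) * \<phi> 1 + (1 - \<pi> (edge (s + i) (s + j))) * \<phi> 0 else \<phi> 0)"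
    if "i < N" "j < N" for i j and \<phi> :: "real \<Rightarrow> real"
  proof -
    have "measure_pmf.expectation D (\<lambda>B. \<phi> (B $$ (i, j)))
        = measure_pmf.expectation (map_pmf (\<lambda>B. B $$ (i, j)) D) \<phi>"
      by simp
    then show ?thesis unfolding entry[OF that] using \<pi> by auto
  qed
  have variance: "measure_pmf.variance D (\<lambda>B. B $$ (i, j)) \<le> \<sigma>\<^sup>2" if "i < N" "j < N" for i j
  proof -
    let ?p = "\<pi> (edge (s + i) (s + j))"
    have "measure_pmf.variance D (\<lambda>B. B $$ (i, j)) = (if i \<noteq> j \<and> W i j then ?p * (1 - ?p)\<^sup>2 + (1 - ?p) * ?p\<^sup>2 else 0)"
      using E[OF that, of "\<lambda>x. x"] E[OF that, of "\<lambda>x. (x - (if i \<noteq> j \<and> W i j then ?p else 0))\<^sup>2"] by auto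
    moreover have "?p * (1 - ?p)\<^sup>2 + (1 - ?p) * ?p\<^sup>2 = ?p - ?p\<^sup>2"
      by (simp add: algebra_simps power2_eq_square)
    moreover have "i \<noteq> j \<Longrightarrow> W i j \<Longrightarrow> ?p - ?p\<^sup>2 \<le> \<sigma>\<^sup>2"
      using var[OF that] zero_le_power2[of ?p] by linarith
    ultimately show ?thesis by auto
  qed
  have "1 - c * N powr (- r) \<le> measure_pmf.prob D {B. operator_norm (B - mean_mat N D) \<le> C * \<sigma> * sqrt N}"
    using const law variance N(1) \<sigma> unfolding concentration_constants_def by blast
  also have "\<dots> = measure_pmf.prob (edge_law n \<pi>) {f. operator_norm (adj f - mean_mat N D) \<le> C * \<sigma> * sqrt N}"
    by (simp add: D_def vimage_def)
  also have "\<dots> \<le> measure_pmf.prob (edge_law n \<pi>)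
    {f. \<forall>u. quad_form N (\<lambda>i j. if i \<noteq> j \<and> W i j
          then of_bool (f (edge (s + i) (s + j))) - \<pi> (edge (s + i) (s + j)) else 0) u
        \<le> C * \<sigma> * sqrt N * (\<Sum>i<N. (u i)\<^sup>2)}"
  proof (intro measure_pmf.finite_measure_mono, clarify)
    fix f u assume f: "operator_norm (adj f - mean_mat N D) \<le> C * \<sigma> * sqrt N"
    have carrier: "adj f - mean_mat N D \<in> carrier_mat N N"
      by (rule minus_carrier_mat) (simp add: mean_mat_def)
    have "quad_form N (\<lambda>i j. if i \<noteq> j \<and> W i j
          then of_bool (f (edge (s + i) (s + j))) - \<pi> (edge (s + i) (s + j)) else 0) u
       = quad_form N (\<lambda>i j. (adj f - mean_mat N D) $$ (i, j)) u"
      unfolding quad_form_def using E[of _ _ "\<lambda>x. x"]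
      by (intro sum.cong refl) (auto simp: adj_def mean_mat_def)
    also have "\<dots> \<le> operator_norm (adj f - mean_mat N D) * (\<Sum>i<N. (u i)\<^sup>2)"
      by (rule quad_form_le_operator_norm[OF carrier])
    also have "\<dots> \<le> C * \<sigma> * sqrt N * (\<Sum>i<N. (u i)\<^sup>2)"
      using f by (intro mult_right_mono) (auto intro: sum_nonneg)
    finally show "quad_form N (\<lambda>i j. if i \<noteq> j \<and> W i j
          then of_bool (f (edge (s + i) (s + j))) - \<pi> (edge (s + i) (s + j)) else 0) u
        \<le> C * \<sigma> * sqrt N * (\<Sum>i<N. (u i)\<^sup>2)" .
  qed auto
  finally show ?thesis .
qed

definition block_prob :: "nat \<Rightarrow> real \<Rightarrow> real \<Rightarrow> nat \<times> nat \<Rightarrow> real" where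
  "block_prob m p q = (\<lambda>(i, j). if i div m = j div m then p else q)"

definition edge_mat :: "real \<Rightarrow> (nat \<times> nat \<Rightarrow> bool) \<Rightarrow> nat \<Rightarrow> nat \<Rightarrow> real" where
  "edge_mat d f i j = (if i = j then d else of_bool (f (edge i j)))"

lemma edge_mat_commute: "edge_mat d f i j = edge_mat d f j i"
  by (simp add: edge_mat_def edge_commute)

lemma block_prob_edge: "block_prob m p q (edge i j) = (if i div m = j div m then p else q)"
  by (auto simp: block_prob_def edge_def min_def max_def)

lemma inj_on_edge: "i \<notin> J \<Longrightarrow> inj_on (edge i) J"
  by (auto simp: inj_on_def edge_def min_def max_def split: if_splits)

text \<open>Disjointness prevents an edge from being met from both ends, so the edge count between
  two blocks is a sum of independent variables.\<close>

lemma inj_on_edge_Times: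
  assumes "A \<inter> B = {}"
  shows "inj_on (\<lambda>(i, j). edge i j) (A \<times> B)"
  using assms by (auto simp: inj_on_def edge_def min_def max_def split: if_splits)

lemma edge_in_pairs: "i < n \<Longrightarrow> j < n \<Longrightarrow> i \<noteq> j \<Longrightarrow> edge i j \<in> {(i, j). i < j \<and> j < n}"
  by (auto simp: edge_def)

lemma edge_image_in_pairs:
  assumes "i < n" "\<And>j. j \<in> J \<Longrightarrow> j < n \<and> i \<noteq> j"
  shows "edge i ` J \<subseteq> {(i, j). i < j \<and> j < n}"
proof (rule image_subsetI)
  fix j assume "j \<in> J"
  then show "edge i j \<in> {(i, j). i < j \<and> j < n}"
    using assms by (intro edge_in_pairs) auto
qed

text \<open>With \<open>p\<close> on the diagonal the mean depends only on the blocks of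
  \<open>i\<close> and \<open>j\<close> and vanishes on block-centred \<open>u\<close>, and the
  centred matrix has zero diagonal. The within-block noise is block diagonal, so a common bound for
  the blocks is a bound for their sum, without a factor \<open>K\<close>.\<close>

lemma quad_form_planted_le:
  fixes p q :: real
  assumes m: "0 < m" and n: "n = m * K"
    and within: "\<And>k u. k < K \<Longrightarrow> quad_form m (\<lambda>i j. if i \<noteq> j
          then of_bool (f (edge (k * m + i) (k * m + j))) - block_prob m p q (edge (k * m + i) (k * m + j))
          else 0) u \<le> \<theta>1 * (\<Sum>i<m. (u i)\<^sup>2)"
    and across: "\<And>u. quad_form n (\<lambda>i j. if i \<noteq> j \<and> i div m \<noteq> j div m
          then of_bool (f (edge i j)) - block_prob m p q (edge i j) else 0) u
        \<le> \<theta>2 * (\<Sum>i<n. (u i)\<^sup>2)"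
    and u: "block_centered m K u"
  shows "quad_form n (edge_mat p f) u \<le> (\<theta>1 + \<theta>2) * (\<Sum>i<n. (u i)\<^sup>2)"
proof -
  define \<Delta> where "\<Delta> i j = (if i \<noteq> j then of_bool (f (edge i j)) - block_prob m p q (edge i j) else 0)"
    for i j
  define mean where "mean i l = (if i div m = l then p else q)" for i l
  have split: "edge_mat p f i j = (if i div m = j div m then \<Delta> i j else 0)
      + (if i \<noteq> j \<and> i div m \<noteq> j div m then of_bool (f (edge i j)) - block_prob m p q (edge i j) else 0)
      + mean i (j div m)" for i j
    by (auto simp: edge_mat_def \<Delta>_def mean_def block_prob_edge)
  have "quad_form n (\<lambda>i j. mean i (j div m)) u = 0"
  proof -
    have "(\<Sum>j<n. mean i (j div m) * u j) = 0" for i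
      unfolding n by (rule sum_block_wise_mult_centered[OF m u])
    then show ?thesis by (simp add: quad_form_eq_sum_mult)
  qed
  moreover have "quad_form n (\<lambda>i j. if i div m = j div m then \<Delta> i j else 0) u \<le> \<theta>1 * (\<Sum>i<n. (u i)\<^sup>2)"
  proof -
    have "quad_form n (\<lambda>i j. if i div m = j div m then \<Delta> i j else 0) u
        = (\<Sum>i<n. \<Sum>j<n. if i div m = j div m then \<Delta> i j * u i * u j else 0)"
      unfolding quad_form_def by (intro sum.cong refl) auto
    also have "\<dots> = (\<Sum>i<n. \<Sum>j\<in>block m (i div m). \<Delta> i j * u i * u j)"
      unfolding n by (intro sum.cong refl sum_same_block[OF m]) auto
    also have "\<dots> = (\<Sum>k<K. \<Sum>i\<in>block m k. \<Sum>j\<in>block m k. \<Delta> i j * u i * u j)"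
      unfolding n sum_blocks block_def[symmetric]
      by (intro sum.cong refl sum_block_const[OF m])
    also have "\<dots> = (\<Sum>k<K. quad_form m (\<lambda>i j. if i \<noteq> j
          then of_bool (f (edge (k * m + i) (k * m + j))) - block_prob m p q (edge (k * m + i) (k * m + j))
          else 0) (\<lambda>i. u (k * m + i)))"
      unfolding quad_form_def sum_block_shift \<Delta>_def by (intro sum.cong refl) auto
    also have "\<dots> \<le> (\<Sum>k<K. \<theta>1 * (\<Sum>i<m. (u (k * m + i))\<^sup>2))"
      by (intro sum_mono within) auto
    also have "\<dots> = \<theta>1 * (\<Sum>i<n. (u i)\<^sup>2)"
      unfolding n sum_blocks block_def[symmetric] sum_block_shift sum_distrib_left ..
    finally show ?thesis .
  qed
  moreover have "quad_form n (edge_mat p f) u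
    = quad_form n (\<lambda>i j. if i div m = j div m then \<Delta> i j else 0) u
    + quad_form n (\<lambda>i j. if i \<noteq> j \<and> i div m \<noteq> j div m
          then of_bool (f (edge i j)) - block_prob m p q (edge i j) else 0) u
    + quad_form n (\<lambda>i j. mean i (j div m)) u"
    unfolding quad_form_def split sum.distrib[symmetric] distrib_right ..
  ultimately show ?thesis using across[of u] by (simp add: distrib_right)
qed

section \<open>Tails of edge counts and the union bound\<close>

lemma edge_sum_upper_tail:
  fixes \<pi> :: "nat \<times> nat \<Rightarrow> real"
  assumes h: "inj_on h J" "h ` J \<subseteq> {(i, j). i < j \<and> j < n}" and \<pi>: "\<And>e. \<pi> e \<in> {0..1}"
    and "(\<Sum>j\<in>J. \<pi> (h j)) \<le> \<nu>" "0 \<le> x"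
  shows "measure_pmf.prob (edge_law n \<pi>)
      {f. \<nu> + (2 * sqrt (\<nu> * x) + x) \<le> (\<Sum>j\<in>J. of_bool (f (h j)))} \<le> exp (- x)"
  using bernoulli_sum_upper_tail[where \<nu> = \<nu> and p = \<pi> and S = "h ` J",
      OF finite_pairs h(2) \<pi> _ assms(5)] assms(4)
  by (simp add: edge_law_def sum.reindex[OF h(1)])

lemma edge_sum_lower_tail:
  fixes \<pi> :: "nat \<times> nat \<Rightarrow> real"
  assumes h: "inj_on h J" "h ` J \<subseteq> {(i, j). i < j \<and> j < n}" and \<pi>: "\<And>e. \<pi> e \<in> {0..1}"
    and "(\<Sum>j\<in>J. \<pi> (h j)) \<le> V" "0 \<le> x"
  shows "measure_pmf.prob (edge_law n \<pi>)
      {f. (\<Sum>j\<in>J. of_bool (f (h j))) < (\<Sum>j\<in>J. \<pi> (h j)) - sqrt (2 * V * x)} \<le> exp (- x)"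
  using bernoulli_sum_lower_tail[where V = V and p = \<pi> and S = "h ` J",
      OF finite_pairs h(2) \<pi> _ assms(5)] assms(4)
  by (simp add: edge_law_def sum.reindex[OF h(1)])

lemma prob_ex_le:
  fixes e :: real
  assumes "finite I" "\<And>i. i \<in> I \<Longrightarrow> measure_pmf.prob P {f. B i f} \<le> e"
  shows "measure_pmf.prob P {f. \<exists>i\<in>I. B i f} \<le> card I * e"
proof -
  have "{f. \<exists>i\<in>I. B i f} = (\<Union>i\<in>I. {f. B i f})" by auto
  then have "measure_pmf.prob P {f. \<exists>i\<in>I. B i f} \<le> (\<Sum>i\<in>I. measure_pmf.prob P {f. B i f})"
    using measure_pmf.finite_measure_subadditive_finite[OF assms(1), of "\<lambda>i. {f. B i f}" P] by auto
  also have "\<dots> \<le> (\<Sum>i\<in>I. e)" by (intro sum_mono assms(2))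
  finally show ?thesis by simp
qed

lemma prob_not_eq: "measure_pmf.prob P {f. \<not> B f} = 1 - measure_pmf.prob P {f. B f}"
  using measure_pmf.prob_compl[of "{f. B f}" P] by (simp add: Compl_eq Compl_eq_Diff_UNIV[symmetric])

section \<open>The separation hypothesis\<close>

text \<open>Bootstrapping: every lower bound on \<open>ln n\<close> enlarges \<open>n\<close>
  through \<open>36 * ln n \<le> n\<close>. Starting from \<open>ln 2 \<ge> 2 / 3\<close>, the
  values 24, 72 and 108 for \<open>n\<close> pass \<open>3^2\<close>, \<open>3^3\<close> and
  \<open>3^4\<close>, while \<open>exp k \<le> 3 ^ k\<close>.\<close>

lemma ln_ge_4:
  fixes n :: nat
  assumes "2 \<le> n" "36 * ln n \<le> n"
  shows "4 \<le> ln n"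
proof -
  have e: "exp (real k) \<le> 3 ^ k" for k
    using power_mono[OF exp_le, of k] by (simp flip: exp_of_nat_mult)
  have step: "real k \<le> ln n" if "3 ^ k \<le> real n" for k
    using order_trans[OF e[of k] that] assms(1) by (simp add: ln_ge_iff)
  have "2 / 3 \<le> ln (real n)"
    by (rule order_trans[OF ln2_ge_two_thirds]) (use assms(1) in simp)
  then have "2 \<le> ln (real n)" using step[of 2] assms(2) by simp
  then have "3 \<le> ln (real n)" using step[of 3] assms(2) by simp
  then show ?thesis using step[of 4] assms(2) by simp
qed

text \<open>Two savings compared with the separation hypothesis make room for very small \<open>a\<close>, where
  neither \<open>a K \<ge> C'\<close> nor a Gaussian upper tail is available: the spectral bound gains a factor
  \<open>sqrt L \<ge> 2\<close>, and the Gaussian lower tail of the degrees needs only \<open>2 (c1 + 1)\<close> instead of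
  \<open>4 (c1 + 1)\<close> below the root.\<close>

lemma separation_budget:
  fixes a P K L C C' c1 c2 S :: real
  assumes C: "0 < C" "0 < C'" and c: "0 < c1" "0 < c2" and a: "0 \<le> a" and K: "1 \<le> K"
    and L: "4 \<le> L" and P: "C' \<le> P"
    and S: "S = max (sqrt (4 * (c1 + 1))) (3 * sqrt (4 * (c2 + 1)))"
    and sep: "(C + S) * (sqrt P + sqrt (a * K)) < P - a"
  shows "sqrt (2 * (c1 + 1) * P)
      + (if K < 2 then 0 else 2 * (2 * sqrt (a * (c2 + 2)) + (c2 + 2)) + sqrt (2 * a * (c2 + 2)))
      + C * (sqrt P + sqrt (max (a * K) C')) / sqrt L < P - a"
    and "36 \<le> P"
proof -
  have P_pos: "0 < P" using C P by simp
  have S_sq: "4 * (c1 + 1) \<le> S\<^sup>2" "36 * (c2 + 1) \<le> S\<^sup>2"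
  proof -
    have "(sqrt (4 * (c1 + 1)))\<^sup>2 \<le> S\<^sup>2" "(3 * sqrt (4 * (c2 + 1)))\<^sup>2 \<le> S\<^sup>2"
      unfolding S by (rule power_mono; use c in simp)+
    then show "4 * (c1 + 1) \<le> S\<^sup>2" "36 * (c2 + 1) \<le> S\<^sup>2"
      using c by (simp_all add: power_mult_distrib)
  qed
  have S_pos: "0 < S" unfolding S using c by (simp add: less_max_iff_disj)
  have aK: "0 \<le> a * K" using a K by simp
  \<comment> \<open>The separation bounds \<open>S\<close> by \<open>sqrt P\<close>. Then
    \<open>S\<^sup>2 \<le> S * sqrt P\<close>, which lets the budget absorb the tail term linear in
    \<open>c2\<close>, and \<open>S\<^sup>2 \<le> P\<close>, which gives
    \<open>36 \<le> P\<close>.\<close>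
  have S_le: "S \<le> sqrt P"
  proof -
    have "S * sqrt P \<le> (C + S) * (sqrt P + sqrt (a * K))"
      using C S_pos P_pos aK by (intro mult_mono) auto
    also have "\<dots> \<le> P" using sep a by simp
    also have "P = sqrt P * sqrt P" using P_pos by simp
    finally show ?thesis by (rule mult_right_le_imp_le) (use P_pos in simp)
  qed
  have S_P: "S\<^sup>2 \<le> S * sqrt P" "S\<^sup>2 \<le> P"
    using S_le S_pos power_mono[OF S_le, of 2] P_pos by (simp_all add: power2_eq_square mult_left_mono)
  show "36 \<le> P" using S_P(2) S_sq(2) c by simp
  \<comment> \<open>The Gaussian lower tail needs the fraction \<open>1 / sqrt 2\<close> of
    \<open>S * sqrt P\<close>; \<open>3 / 4\<close> is a rational bound for it, and the remaining
    quarter pays for \<open>2 * (c2 + 2)\<close> in \<open>cross\<close>.\<close>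
  have deg: "sqrt (2 * (c1 + 1) * P) \<le> 3 / 4 * (S * sqrt P)"
  proof (rule real_le_lsqrt)
    have "(3 / 4 * (S * sqrt P))\<^sup>2 = 9 / 16 * S\<^sup>2 * P"
      using P_pos by (simp add: power_mult_distrib power2_eq_square)
    moreover have "2 * (c1 + 1) * P \<le> 9 / 16 * S\<^sup>2 * P"
      using S_sq(1) c P_pos by (intro mult_right_mono) auto
    ultimately show "2 * (c1 + 1) * P \<le> (3 / 4 * (S * sqrt P))\<^sup>2" by simp
  qed (use c P_pos S_pos in auto)
  have cross: "(if K < 2 then 0 else 2 * (2 * sqrt (a * (c2 + 2)) + (c2 + 2)) + sqrt (2 * a * (c2 + 2)))
      \<le> S * sqrt P / 4 + S * sqrt (a * K)"
  proof (cases "K < 2")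
    case False
    have "sqrt (2 * a * (c2 + 2)) \<le> 2 * sqrt (a * (c2 + 2))"
    proof (rule real_le_lsqrt)
      have "0 \<le> a * (c2 + 2)" using a c by simp
      then have "(2 * sqrt (a * (c2 + 2)))\<^sup>2 = 4 * (a * (c2 + 2))" by (simp add: power_mult_distrib)
      then show "2 * a * (c2 + 2) \<le> (2 * sqrt (a * (c2 + 2)))\<^sup>2"
        using \<open>0 \<le> a * (c2 + 2)\<close> by simp
    qed (use a c in auto)
    \<comment> \<open>The 6 collects 4 from two upper tails and at most 2 from the lower tail.
      \<open>S\<close> contains only \<open>c2 + 1\<close>; the factor \<open>K \<ge> 2\<close>
      closes the difference, as \<open>c2 + 2 \<le> 2 * (c2 + 1)\<close>.\<close>
    moreover have "6 * sqrt (a * (c2 + 2)) \<le> S * sqrt (a * K)"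
    proof -
      have "36 * (c2 + 2) \<le> S\<^sup>2 * K"
      proof -
        have "36 * (c2 + 2) \<le> S\<^sup>2 * 2" using S_sq(2) c by simp
        also have "\<dots> \<le> S\<^sup>2 * K" using False by (intro mult_left_mono) auto
        finally show ?thesis .
      qed
      then have "a * (36 * (c2 + 2)) \<le> a * (S\<^sup>2 * K)" using a by (rule mult_left_mono)
      then have "sqrt (36 * (a * (c2 + 2))) \<le> sqrt (S\<^sup>2 * (a * K))" by (simp add: mult_ac)
      then show ?thesis using S_pos by (simp add: real_sqrt_mult)
    qed
    moreover have "2 * (c2 + 2) \<le> S * sqrt P / 4"
      using S_sq(2) S_P(1) c by simp
    ultimately show ?thesis using False by simp
  qed (use S_pos P_pos aK in simp)
  \<comment> \<open>Since \<open>C' \<le> P\<close>, raising the variance at most doubles the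
    bracket, and \<open>sqrt L \<ge> 2\<close> pays for the doubling.\<close>
  have spectral: "C * (sqrt P + sqrt (max (a * K) C')) / sqrt L \<le> C * (sqrt P + sqrt (a * K))"
  proof -
    have "sqrt (max (a * K) C') \<le> sqrt P + sqrt (a * K)"
      using P aK P_pos by (cases "a * K \<le> C'") (auto simp: max_def intro: order_trans[OF real_sqrt_le_mono])
    moreover have "x \<le> y + z \<Longrightarrow> 0 \<le> z \<Longrightarrow> y + x \<le> 2 * (y + z)" for x y z :: real
      by simp
    ultimately have "sqrt P + sqrt (max (a * K) C') \<le> 2 * (sqrt P + sqrt (a * K))"
      using real_sqrt_ge_zero[OF aK] by blast
    then have "C * (sqrt P + sqrt (max (a * K) C')) \<le> C * (2 * (sqrt P + sqrt (a * K)))"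
      using C by (intro mult_left_mono) auto
    also have "\<dots> \<le> C * (sqrt L * (sqrt P + sqrt (a * K)))"
      using C aK P_pos L real_sqrt_le_mono[OF L] by (intro mult_left_mono mult_right_mono) auto
    finally show ?thesis using L by (simp add: pos_divide_le_eq mult_ac)
  qed
  show "sqrt (2 * (c1 + 1) * P)
      + (if K < 2 then 0 else 2 * (2 * sqrt (a * (c2 + 2)) + (c2 + 2)) + sqrt (2 * a * (c2 + 2)))
      + C * (sqrt P + sqrt (max (a * K) C')) / sqrt L < P - a"
    using deg cross spectral sep by (simp add: algebra_simps)
qed

text \<open>This is the budget multiplied by \<open>L\<close>. In the tail terms both the variance
  and the exponent carry a factor \<open>L\<close>, so they scale by \<open>L\<close>; in the
  spectral terms only the variance does, which is the source of the division by
  \<open>sqrt L\<close>.\<close>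

lemma separation_budget_scaled:
  fixes p q C C' c1 c2 S L :: real and m K n :: nat
  assumes C: "0 < C" "0 < C'" and c: "0 < c1" "0 < c2" and q: "0 \<le> q" and p: "0 \<le> p"
    and m: "1 \<le> m" and K: "1 \<le> K" and n: "n = m * K" and L: "4 \<le> L"
    and P: "C' \<le> p * m / L"
    and S: "S = max (sqrt (4 * (c1 + 1))) (3 * sqrt (4 * (c2 + 1)))"
    and sep: "(C + S) * (sqrt (p * m / L) + sqrt (q * m / L * K)) < p * m / L - q * m / L"
  shows "C * sqrt p * sqrt m + C * sqrt (max q (C' * L / n)) * sqrt n
     + (q * m + (if K < 2 then 0 else 2 * (2 * sqrt (q * m * ((c2 + 2) * L)) + (c2 + 2) * L)
          + sqrt (2 * (q * m) * ((c2 + 2) * L))))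
     < p * m - sqrt (2 * (p * m) * ((c1 + 1) * L))"
proof -
  define P where "P = p * m / L"
  define a where "a = q * m / L"
  have pm: "p * m = P * L" and qm: "q * m = a * L" using L by (simp_all add: P_def a_def)
  have a: "0 \<le> a" using q L by (simp add: a_def)
  have L_sqrt: "sqrt (x * L * L) = L * sqrt x" for x
    using L by (simp add: real_sqrt_mult mult.assoc)
  have "sqrt (2 * (c1 + 1) * P)
      + (if real K < 2 then 0 else 2 * (2 * sqrt (a * (c2 + 2)) + (c2 + 2)) + sqrt (2 * a * (c2 + 2)))
      + C * (sqrt P + sqrt (max (a * K) C')) / sqrt L < P - a" (is "?lhs < _")
    using K P sep by (intro separation_budget(1)[OF C c a _ L _ S]) (auto simp: P_def a_def)
  then have budget: "L * ?lhs < L * (P - a)" using L by simp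
  have deg: "sqrt (2 * (p * m) * ((c1 + 1) * L)) = L * sqrt (2 * (c1 + 1) * P)"
    unfolding pm L_sqrt[symmetric] by (simp add: mult_ac)
  have cross: "sqrt (q * m * ((c2 + 2) * L)) = L * sqrt (a * (c2 + 2))"
    "sqrt (2 * (q * m) * ((c2 + 2) * L)) = L * sqrt (2 * a * (c2 + 2))"
    unfolding qm L_sqrt[symmetric] by (simp_all add: mult_ac)
  have L_div: "L * (x / sqrt L) = sqrt L * x" for x
    using L by (simp add: field_simps flip: real_sqrt_mult)
  have within: "sqrt p * sqrt m = L * (sqrt P / sqrt L)"
    unfolding L_div by (simp add: pm mult.commute flip: real_sqrt_mult)
  have "max q (C' * L / n) * n = L * max (a * K) C'"
  proof -
    have "max q (C' * L / n) * n = max (q * n) (C' * L)"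
      using m K n by (subst max_mult_distrib_right) simp
    also have "q * n = L * (a * K)"
      using qm by (simp add: n mult_ac)
    also have "max (L * (a * K)) (C' * L) = L * max (a * K) C'"
      using L by (simp add: max_mult_distrib_left mult.commute[of C'])
    finally show ?thesis .
  qed
  then have across: "sqrt (max q (C' * L / n)) * sqrt n = L * (sqrt (max (a * K) C') / sqrt L)"
    unfolding L_div by (simp flip: real_sqrt_mult)
  have "C * sqrt p * sqrt m + C * sqrt (max q (C' * L / n)) * sqrt n
      = L * (C * (sqrt P + sqrt (max (a * K) C')) / sqrt L)"
    unfolding mult.assoc within across by (simp add: add_divide_distrib algebra_simps)
  moreover have "(if K < 2 then 0 else 2 * (2 * sqrt (q * m * ((c2 + 2) * L)) + (c2 + 2) * L)
          + sqrt (2 * (q * m) * ((c2 + 2) * L)))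
      = L * (if real K < 2 then 0 else 2 * (2 * sqrt (a * (c2 + 2)) + (c2 + 2)) + sqrt (2 * a * (c2 + 2)))"
    unfolding cross by (simp add: algebra_simps)
  moreover have "L * u + L * v + L * w < L * y - L * z" if "L * (u + v + w) < L * (y - z)" for u v w y z
    using that by (simp add: algebra_simps)
  note this[OF budget]
  ultimately show ?thesis
    using deg
      pm[unfolded mult.commute[of P]] qm[unfolded mult.commute[of a]] by linarith
qed

section \<open>Exact recovery\<close>

text \<open>The diagonal of the data is replaced by \<open>p\<close>, so that the mean is block-constant and vanishes
  on block-centred vectors.\<close>

lemma edge_law_exact_recovery:
  fixes m K n :: nat and p q C C' c r c1 c2 S L :: real
  assumes const: "concentration_constants C C' c r"
    and m: "1 \<le> m" and K: "1 \<le> K" and n: "n = m * K"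
    and q: "0 \<le> q" and qp: "q < p" and p: "p \<le> 1" and c1: "0 < c1" and c2: "0 < c2"
    and L: "L = ln n"
    and S: "S = max (sqrt (4 * (c1 + 1))) (3 * sqrt (4 * (c2 + 1)))"
    and P: "C' \<le> p * m / L"
    and sep: "(C + S) * (sqrt (p * m / L) + sqrt (q * m / L * K)) < p * m / L - q * m / L"
  shows "1 - c * (real K * real m powr (- r) + real n powr (- r)) - real n powr (- c1)
        - 2 * (1 / real m) * real n powr (- c2)
      \<le> measure_pmf.prob (edge_law n (block_prob m p q))
        {f. {X. sdp2'_solution n K (Matrix.mat n n (\<lambda>(i, j). edge_mat p f i j)) X} = {true_cluster_mat m K}}"
    (is "?lower \<le> measure_pmf.prob ?P {f. ?success f}")
proof -
  have C: "0 < C" "0 < C'" using const by (auto simp: concentration_constants_def)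
  have m0: "0 < m" using m by simp
  have mn: "m \<le> n" using K n by simp
  have n1: "1 \<le> n" using m K n by simp
  have p0: "0 < p" using q qp by simp
  \<comment> \<open>For \<open>L = 0\<close> the quotient in \<open>P\<close> would be 0 by the
    convention on division, contradicting \<open>C' > 0\<close>. This excludes
    \<open>n = 1\<close>.\<close>
  have "L \<noteq> 0" using P C by auto
  then have "n \<noteq> 1" using L by auto
  then have n2: "2 \<le> n" using n1 by simp
  have L0: "0 < L" using n2 L by simp
  \<comment> \<open>The parameter \<open>L\<close> of the budget is instantiated by 4 through
    \<open>order_refl\<close>: the bound \<open>4 \<le> L\<close> is itself derived from this
    inequality.\<close>
  have "36 \<le> p * m / L"
    using q L0 K by (intro separation_budget(2)[OF C c1 c2 _ _ order_refl P S sep]) auto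
  then have "36 * L \<le> p * m" using L0 by (simp add: pos_le_divide_eq)
  also have "p * m \<le> m" using p p0 by (simp add: mult_left_le_one_le)
  also have "real m \<le> n" using mn by simp
  finally have L4: "4 \<le> L" using ln_ge_4[OF n2] L by simp
  define \<pi> where "\<pi> = block_prob m p q"
  have \<pi>: "\<pi> e \<in> {0..1}" for e using q qp p by (auto simp: \<pi>_def block_prob_def split: prod.split)
  \<comment> \<open>A union over \<open>n\<close> vertices costs one power of \<open>n\<close>. The
    pairs in \<open>off1\<close> and in \<open>off2\<close> number at most
    \<open>n * K = n\<^sup>2 / m\<close> each, which costs two powers and leaves the factor
    \<open>1 / m\<close>.\<close>
  define x1 where "x1 = (c1 + 1) * L"
  define x2 where "x2 = (c2 + 2) * L"
  have x: "0 \<le> x1" "0 \<le> x2" using c1 c2 L0 by (simp_all add: x1_def x2_def)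
  define \<sigma> where "\<sigma> = sqrt (max q (C' * L / n))"
  define t where "t = 2 * sqrt (q * m * x2) + x2"
  have in_block: "i div m < K" if "i < n" for i
    using that n by (simp add: less_mult_imp_div_less mult.commute)
  have less_n: "i < n" if "i \<in> block m k" "k < K" for i k
    using block_less[OF that] n by simp

  define within_noise where "within_noise k f \<longleftrightarrow> (\<forall>u. quad_form m (\<lambda>i j. if i \<noteq> j \<and> True
      then of_bool (f (edge (k * m + i) (k * m + j))) - \<pi> (edge (k * m + i) (k * m + j)) else 0) u
    \<le> C * sqrt p * sqrt m * (\<Sum>i<m. (u i)\<^sup>2))" for k f
  define across_noise where "across_noise f \<longleftrightarrow> (\<forall>u. quad_form n (\<lambda>i j. if i \<noteq> j \<and> i div m \<noteq> j div m
      then of_bool (f (edge (0 + i) (0 + j))) - \<pi> (edge (0 + i) (0 + j)) else 0) u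
    \<le> C * \<sigma> * sqrt n * (\<Sum>i<n. (u i)\<^sup>2))" for f
  define low_degree where "low_degree i f \<longleftrightarrow> (\<Sum>j\<in>block m (i div m) - {i}. of_bool (f (edge i j)))
    < (\<Sum>j\<in>block m (i div m) - {i}. \<pi> (edge i j)) - sqrt (2 * (p * m) * x1)" for i f
  define high_degree where "high_degree = (\<lambda>(i, l) f. q * m + t \<le> (\<Sum>j\<in>block m l. of_bool (f (edge i j))))"
  define low_count where "low_count = (\<lambda>(k, l) f. (\<Sum>(i, j)\<in>block m k \<times> block m l. of_bool (f (edge i j)))
    < (\<Sum>(i, j)\<in>block m k \<times> block m l. \<pi> (edge i j)) - sqrt (2 * (q * (m * m)) * x2))"
  define off1 where "off1 = {(i, l). i < n \<and> l < K \<and> i div m \<noteq> l}"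
  define off2 where "off2 = {(k, l). k < K \<and> l < K \<and> k \<noteq> l}"

  have bad_within: "measure_pmf.prob ?P {f. \<exists>k\<in>{..<K}. \<not> within_noise k f} \<le> card {..<K} * (c * m powr (- r))"
  proof (rule prob_ex_le)
    fix k assume "k \<in> {..<K}"
    then have "k * m + m \<le> n"
      using n by (metis Suc_leI add.commute lessThan_iff mult.commute mult_Suc mult_le_mono2)
    moreover have "\<pi> (edge (k * m + i) (k * m + j)) \<le> (sqrt p)\<^sup>2" for i j
      using q qp by (simp add: \<pi>_def block_prob_edge)
    moreover have "C' * ln m \<le> m * (sqrt p)\<^sup>2"
    proof -
      have "C' * ln m \<le> C' * L" using m mn C L by (intro mult_left_mono) auto
      also have "\<dots> \<le> p * m" using P L0 by (simp add: pos_le_divide_eq)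
      finally show ?thesis using p0 by (simp add: mult.commute)
    qed
    ultimately have "1 - c * m powr (- r) \<le> measure_pmf.prob ?P {f. within_noise k f}"
      unfolding within_noise_def \<pi>_def[symmetric] using m \<pi> p0
      by (intro edge_law_concentration[OF const]) auto
    then show "measure_pmf.prob ?P {f. \<not> within_noise k f} \<le> c * m powr (- r)"
      unfolding prob_not_eq by simp
  qed simp

  have bad_across: "measure_pmf.prob ?P {f. \<not> across_noise f} \<le> c * n powr (- r)"
  proof -
    have \<sigma>_nonneg: "0 \<le> \<sigma>" using q by (simp add: \<sigma>_def le_max_iff_disj)
    have \<sigma>_sq: "\<sigma>\<^sup>2 = max q (C' * L / n)" using q by (simp add: \<sigma>_def le_max_iff_disj)
    have "\<pi> (edge (0 + i) (0 + j)) \<le> \<sigma>\<^sup>2" if "i div m \<noteq> j div m" for i j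
      using that by (simp add: \<pi>_def block_prob_edge \<sigma>_sq)
    moreover have "C' * ln n \<le> n * \<sigma>\<^sup>2"
    proof -
      have "C' * ln n = n * (C' * L / n)" using n1 L by simp
      also have "\<dots> \<le> n * \<sigma>\<^sup>2" unfolding \<sigma>_sq by (intro mult_left_mono) auto
      finally show ?thesis .
    qed
    ultimately have "1 - c * n powr (- r) \<le> measure_pmf.prob ?P {f. across_noise f}"
      unfolding across_noise_def \<pi>_def[symmetric] using n1 \<pi> \<sigma>_nonneg
      by (intro edge_law_concentration[OF const]) auto
    then show ?thesis unfolding prob_not_eq by simp
  qed

  have bad_low_degree: "measure_pmf.prob ?P {f. \<exists>i\<in>{..<n}. low_degree i f} \<le> card {..<n} * exp (- x1)"
  proof (rule prob_ex_le)
    fix i assume "i \<in> {..<n}"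
    then have i: "i < n" by simp
    have "edge i ` (block m (i div m) - {i}) \<subseteq> {(i, j). i < j \<and> j < n}"
      using less_n[OF _ in_block[OF i]] by (intro edge_image_in_pairs i) auto
    moreover have "(\<Sum>j\<in>block m (i div m) - {i}. \<pi> (edge i j)) \<le> p * m"
    proof -
      have "(\<Sum>j\<in>block m (i div m) - {i}. \<pi> (edge i j)) \<le> (\<Sum>j\<in>block m (i div m). p)"
        using q qp finite_block by (intro order_trans[OF sum_mono sum_mono2]) (auto simp: \<pi>_def block_prob_edge)
      then show ?thesis by (simp add: card_block mult.commute)
    qed
    ultimately show "measure_pmf.prob ?P {f. low_degree i f} \<le> exp (- x1)"
      unfolding low_degree_def \<pi>_def[symmetric] using \<pi> x
      by (intro edge_sum_lower_tail inj_on_edge) auto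
  qed simp

  have bad_high_degree: "measure_pmf.prob ?P {f. \<exists>z\<in>off1. high_degree z f} \<le> card off1 * exp (- x2)"
  proof (rule prob_ex_le)
    show "finite off1" by (rule finite_subset[of _ "{..<n} \<times> {..<K}"]) (auto simp: off1_def)
    fix z assume "z \<in> off1"
    then obtain i l where z: "z = (i, l)" and il: "i < n" "l < K" "i div m \<noteq> l"
      by (auto simp: off1_def)
    have i_notin: "i \<notin> block m l" using il in_block_iff[OF m0] by simp
    have "edge i ` block m l \<subseteq> {(i, j). i < j \<and> j < n}"
      using less_n[OF _ il(2)] i_notin by (intro edge_image_in_pairs il(1)) auto
    moreover have "(\<Sum>j\<in>block m l. \<pi> (edge i j)) \<le> q * m"
    proof -
      have "(\<Sum>j\<in>block m l. \<pi> (edge i j)) = (\<Sum>j\<in>block m l. q)"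
        using il in_block_iff[OF m0] by (intro sum.cong) (auto simp: \<pi>_def block_prob_edge)
      then show ?thesis by (simp add: card_block mult.commute)
    qed
    ultimately show "measure_pmf.prob ?P {f. high_degree z f} \<le> exp (- x2)"
      unfolding high_degree_def z prod.case \<pi>_def[symmetric] t_def using \<pi> x i_notin
      by (intro edge_sum_upper_tail inj_on_edge) auto
  qed

  have sum_pair: "(\<Sum>(i, j)\<in>block m k \<times> block m l. \<pi> (edge i j)) = q * (m * m)" if "k \<noteq> l" for k l
  proof -
    have "(\<Sum>(i, j)\<in>block m k \<times> block m l. \<pi> (edge i j)) = (\<Sum>z\<in>block m k \<times> block m l. q)"
      using that in_block_iff[OF m0] by (intro sum.cong) (auto simp: \<pi>_def block_prob_edge)
    then show ?thesis by (simp add: card_cartesian_product card_block mult.commute)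
  qed
  have bad_low_count: "measure_pmf.prob ?P {f. \<exists>z\<in>off2. low_count z f} \<le> card off2 * exp (- x2)"
  proof (rule prob_ex_le)
    show "finite off2" by (rule finite_subset[of _ "{..<K} \<times> {..<K}"]) (auto simp: off2_def)
    fix z assume "z \<in> off2"
    then obtain k l where z: "z = (k, l)" and kl: "k < K" "l < K" "k \<noteq> l"
      by (auto simp: off2_def)
    have disj: "block m k \<inter> block m l = {}" using kl in_block_iff[OF m0] by auto
    have "(\<lambda>(i, j). edge i j) ` (block m k \<times> block m l) \<subseteq> {(i, j). i < j \<and> j < n}"
    proof (rule image_subsetI)
      fix z assume "z \<in> block m k \<times> block m l"
      then obtain i j where z': "z = (i, j)" and "i \<in> block m k" "j \<in> block m l" by auto
      then have "edge i j \<in> {(i, j). i < j \<and> j < n}"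
        using less_n kl(1,2) disj by (intro edge_in_pairs) auto
      then show "(\<lambda>(i, j). edge i j) z \<in> {(i, j). i < j \<and> j < n}"
        unfolding z' by simp
    qed
    moreover have "(\<Sum>z\<in>block m k \<times> block m l. \<pi> ((\<lambda>(i, j). edge i j) z)) \<le> q * (m * m)"
      using sum_pair[OF kl(3)] by (simp add: case_prod_unfold)
    ultimately have "measure_pmf.prob ?P {f. (\<Sum>z\<in>block m k \<times> block m l. of_bool (f ((\<lambda>(i, j). edge i j) z)))
        < (\<Sum>z\<in>block m k \<times> block m l. \<pi> ((\<lambda>(i, j). edge i j) z)) - sqrt (2 * (q * (m * m)) * x2)} \<le> exp (- x2)"
      unfolding \<pi>_def[symmetric] using \<pi> x disj
      by (intro edge_sum_lower_tail inj_on_edge_Times) auto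
    then show "measure_pmf.prob ?P {f. low_count z f} \<le> exp (- x2)"
      unfolding low_count_def z by (simp add: case_prod_unfold)
  qed

  define bad where "bad f \<longleftrightarrow> (\<exists>k\<in>{..<K}. \<not> within_noise k f) \<or> \<not> across_noise f \<or> (\<exists>i\<in>{..<n}. low_degree i f)
    \<or> (\<exists>z\<in>off1. high_degree z f) \<or> (\<exists>z\<in>off2. low_count z f)" for f
  have success: "?success f" if "\<not> bad f" for f
  proof -
    have f: "\<And>k. k < K \<Longrightarrow> within_noise k f" "across_noise f" "\<And>i. i < n \<Longrightarrow> \<not> low_degree i f"
      "\<And>z. z \<in> off1 \<Longrightarrow> \<not> high_degree z f" "\<And>z. z \<in> off2 \<Longrightarrow> \<not> low_count z f"
      using that by (auto simp: bad_def)
    define \<theta> where "\<theta> = C * sqrt p * sqrt m + C * \<sigma> * sqrt n"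
    \<comment> \<open>Two foreign degrees of at most \<open>q * m + t\<close> minus an average of at
      least \<open>q * m - sqrt (2 * (q * m) * x2)\<close>. With a single block there are no foreign
      degrees to control and no deviation is charged.\<close>
    define \<mu> where "\<mu> = (q * m + (if K < 2 then 0 else 2 * t + sqrt (2 * (q * m) * x2))) / m"
    have \<mu>m: "\<mu> * m = q * m + (if K < 2 then 0 else 2 * t + sqrt (2 * (q * m) * x2))"
      using m0 by (simp add: \<mu>_def)
    have budget: "\<theta> + \<mu> * m < p * m - sqrt (2 * (p * m) * x1)"
      unfolding \<theta>_def \<mu>m t_def x1_def x2_def \<sigma>_def
      using p0 by (intro separation_budget_scaled[OF C c1 c2 q _ m K n L4 P S sep]) simp
    show ?thesis
    proof (rule sdp2'_unique_solution[OF m0 K n])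
      show "edge_mat p f i j = edge_mat p f j i" for i j by (rule edge_mat_commute)
      show "quad_form n (edge_mat p f) u \<le> \<theta> * (\<Sum>i<n. (u i)\<^sup>2)" if "block_centered m K u" for u
        unfolding \<theta>_def
        using f(1,2) unfolding within_noise_def across_noise_def \<pi>_def add_0
        by (intro quad_form_planted_le[OF m0 n _ _ that]) auto
    next
      fix i assume i: "i < n"
      let ?B = "block m (i div m)"
      have i_in: "i \<in> ?B" using in_block_iff[OF m0] by simp
      \<comment> \<open>The diagonal entry \<open>p\<close> replaces exactly the mean missing at
        \<open>i\<close>, so the expected degree is the full \<open>p * m\<close>.\<close>
      have "(\<Sum>j\<in>?B. edge_mat p f i j) = p + (\<Sum>j\<in>?B - {i}. of_bool (f (edge i j)))"
        by (subst sum.remove[OF finite_block i_in]) (auto simp: edge_mat_def intro!: sum.cong)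
      moreover have "(\<Sum>j\<in>?B - {i}. \<pi> (edge i j)) = p * m - p"
      proof -
        have "(\<Sum>j\<in>?B - {i}. \<pi> (edge i j)) = (\<Sum>j\<in>?B - {i}. p)"
          using in_block_iff[OF m0] by (intro sum.cong) (auto simp: \<pi>_def block_prob_edge)
        also have "\<dots> = (real m - 1) * p"
          using i_in m finite_block by (simp add: card_Diff_singleton card_block of_nat_diff)
        finally show ?thesis by (simp add: algebra_simps)
      qed
      ultimately show "\<theta> + \<mu> * m < (\<Sum>j\<in>?B. edge_mat p f i j)"
        using f(3)[OF i] budget by (simp add: low_degree_def)
    next
      fix i j assume ij: "i < n" "j < n" and ne: "i div m \<noteq> j div m"
      let ?k = "i div m" and ?l = "j div m"
      have kl: "?k < K" "?l < K" using in_block ij by auto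
      then have K2: "\<not> K < 2" using ne by linarith
      have row: "(\<Sum>j'\<in>block m l. edge_mat p f i' j') \<le> q * m + t" if "i' < n" "l < K" "i' div m \<noteq> l" for i' l
      proof -
        have "(\<Sum>j'\<in>block m l. edge_mat p f i' j') = (\<Sum>j'\<in>block m l. of_bool (f (edge i' j')))"
          using that in_block_iff[OF m0] by (intro sum.cong) (auto simp: edge_mat_def)
        then show ?thesis using f(4)[of "(i', l)"] that by (simp add: off1_def high_degree_def)
      qed
      have "(\<Sum>i'\<in>block m ?k. \<Sum>j'\<in>block m ?l. edge_mat p f i' j')
          = (\<Sum>(i', j')\<in>block m ?k \<times> block m ?l. of_bool (f (edge i' j')))"
        unfolding sum.cartesian_product[symmetric]
        using ne in_block_iff[OF m0] by (intro sum.cong refl) (auto simp: edge_mat_def)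
      also have "\<dots> \<ge> q * (m * m) - sqrt (2 * (q * (m * m)) * x2)"
        using f(5)[of "(?k, ?l)"] kl ne sum_pair[OF ne] by (simp add: off2_def low_count_def)
      finally have "(q * (m * m) - sqrt (2 * (q * (m * m)) * x2)) / m
          \<le> (\<Sum>i'\<in>block m ?k. \<Sum>j'\<in>block m ?l. edge_mat p f i' j') / m"
        by (intro divide_right_mono) auto
      \<comment> \<open>Averaging over a block leaves only the deviation
        \<open>sqrt (2 * q * x2)\<close>; it is enlarged to the form in which \<open>\<mu>\<close>
        provides for it.\<close>
      moreover have "(q * (m * m) - sqrt (2 * (q * (m * m)) * x2)) / m \<ge> q * m - sqrt (2 * (q * m) * x2)"
      proof -
        have "sqrt (2 * (q * (m * m)) * x2) = m * sqrt (2 * q * x2)"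
          using m0 by (simp add: real_sqrt_mult mult_ac)
        moreover have "sqrt (2 * q * x2) \<le> sqrt (2 * (q * m) * x2)"
          using q x m by (simp add: mult_left_mono mult_right_mono mult_le_cancel_left1)
        ultimately show ?thesis using m0 by (simp add: diff_divide_distrib)
      qed
      ultimately show "(\<Sum>j'\<in>block m ?l. edge_mat p f i j') + (\<Sum>i'\<in>block m ?k. edge_mat p f j i')
          - (\<Sum>i'\<in>block m ?k. \<Sum>j'\<in>block m ?l. edge_mat p f i' j') / m \<le> \<mu> * m"
        using row[OF ij(1) kl(2) ne] row[OF ij(2) kl(1)] ne K2 unfolding \<mu>m by simp
    qed (auto)
  qed

  have "measure_pmf.prob ?P {f. bad f} \<le> K * (c * m powr (- r)) + c * n powr (- r) + n * exp (- x1)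
      + card off1 * exp (- x2) + card off2 * exp (- x2)"
  proof -
    have un: "measure_pmf.prob ?P {f. Q f \<or> R f} \<le> measure_pmf.prob ?P {f. Q f} + measure_pmf.prob ?P {f. R f}"
      for Q R
      using measure_Un_le[of "{f. Q f}" "measure_pmf ?P" "{f. R f}"] by (simp add: Collect_disj_eq)
    show ?thesis
      unfolding bad_def
      using un[of "\<lambda>f. \<exists>k\<in>{..<K}. \<not> within_noise k f" "\<lambda>f. \<not> across_noise f \<or> (\<exists>i\<in>{..<n}. low_degree i f)
          \<or> (\<exists>z\<in>off1. high_degree z f) \<or> (\<exists>z\<in>off2. low_count z f)"]
        un[of "\<lambda>f. \<not> across_noise f" "\<lambda>f. (\<exists>i\<in>{..<n}. low_degree i f)
          \<or> (\<exists>z\<in>off1. high_degree z f) \<or> (\<exists>z\<in>off2. low_count z f)"]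
        un[of "\<lambda>f. \<exists>i\<in>{..<n}. low_degree i f" "\<lambda>f. (\<exists>z\<in>off1. high_degree z f) \<or> (\<exists>z\<in>off2. low_count z f)"]
        un[of "\<lambda>f. \<exists>z\<in>off1. high_degree z f" "\<lambda>f. \<exists>z\<in>off2. low_count z f"]
        bad_within bad_across bad_low_degree bad_high_degree bad_low_count
      by (simp only: card_lessThan)
  qed
  also have "\<dots> \<le> K * (c * m powr (- r)) + c * n powr (- r) + n powr (- c1) + 2 * (1 / m) * n powr (- c2)"
  proof -
    have exp_x: "exp (- ((c0 + k) * L)) = n powr (- c0) * n powr (- k)" for c0 k
      using n1 L by (simp add: powr_def algebra_simps flip: exp_add)
    have "n * exp (- x1) = n powr (- c1)"
      using n1 unfolding x1_def exp_x by (simp add: powr_minus_divide)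
    moreover have "card off1 * exp (- x2) \<le> n * K * exp (- x2)"
    proof (rule mult_right_mono)
      have "card off1 \<le> card ({..<n} \<times> {..<K})" by (rule card_mono) (auto simp: off1_def)
      then show "real (card off1) \<le> n * K" by (simp flip: of_nat_mult)
    qed simp
    moreover have "card off2 * exp (- x2) \<le> n * K * exp (- x2)"
    proof (rule mult_right_mono)
      have "card off2 \<le> card ({..<K} \<times> {..<K})" by (rule card_mono) (auto simp: off2_def)
      also have "\<dots> \<le> n * K" using m n by simp
      finally show "real (card off2) \<le> n * K" by (simp flip: of_nat_mult)
    qed simp
    moreover have "n * K * exp (- x2) = 1 / m * n powr (- c2)"
      using m0 K unfolding x2_def exp_x
      by (simp add: n powr_minus_divide powr_numeral power2_eq_square)
    ultimately show ?thesis by linarith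
  qed
  finally have "?lower \<le> measure_pmf.prob ?P {f. \<not> bad f}"
    unfolding prob_not_eq by (simp add: algebra_simps)
  also have "\<dots> \<le> measure_pmf.prob ?P {f. ?success f}"
    using success by (intro measure_pmf.finite_measure_mono) auto
  finally show ?thesis .
qed

theorem theorem4p1:
  fixes M :: "'w measure" and A :: "'w \<Rightarrow> real mat"
    and m K n :: nat
    and p q C C' c r c1 c2 C1 C2 pt qt :: real
  assumes "prob_space M"
    and "concentration_constants C C' c r"
    and "m \<ge> 1" and "K \<ge> 1" and "n = m * K"
    and "0 \<le> q" and "q < p" and "p \<le> 1"
    and "planted_partition_bal M m K p q A"
    and "c1 > 0" and "c2 > 0"
    and "C1 = max C' (4 / 9 * (c1 + 1))"
    and "C2 = C + max (sqrt (4 * (c1 + 1))) (3 * sqrt (4 * (c2 + 1)))"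
    and "pt = scaled_param m n p" and "qt = scaled_param m n q"
    and "pt \<ge> C1"
    and "pt - qt > C2 * (sqrt pt + sqrt (qt * real K))"
  shows "measure M {\<omega> \<in> space M. {X. sdp2'_solution n K (A \<omega>) X} = {true_cluster_mat m K}}
           \<ge> 1 - c * (real K * real m powr (- r) + real n powr (- r))
               - real n powr (- c1) - 2 * (1 / real m) * real n powr (- c2)"
proof -
  interpret prob_space M by fact
  let ?I = "{(i, j). i < j \<and> j < n}"
  define X where "X = (\<lambda>(i, j) \<omega>. A \<omega> $$ (i, j))"
  define success where "success f \<longleftrightarrow>
    {X. sdp2'_solution n K (Matrix.mat n n (\<lambda>(i, j). edge_mat p f i j)) X} = {true_cluster_mat m K}" for f
  note planted = assms(9)[unfolded planted_partition_bal_def, folded assms(5)]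
  have binary: "X e \<omega> \<in> {0, 1}" if "e \<in> ?I" "\<omega> \<in> space M" for e \<omega>
    using planted that by (auto simp: X_def)
  \<comment> \<open>The solution set depends only on the entries above the diagonal: symmetry
    supplies those below, and the diagonal may be set to \<open>p\<close>. This turns the event into
    one about the edge configuration.\<close>
  have same_solutions: "{X. sdp2'_solution n K (A \<omega>) X} = {true_cluster_mat m K}
      \<longleftrightarrow> success (\<lambda>e. e \<in> ?I \<and> X e \<omega> = 1)" if "\<omega> \<in> space M" for \<omega>
  proof -
    have A: "A \<omega> \<in> carrier_mat n n" and sym: "symmetric_mat (A \<omega>)"
      using planted that by auto
    have "A \<omega> $$ (i, j) = edge_mat p (\<lambda>e. e \<in> ?I \<and> X e \<omega> = 1) i j" if "i < n" "j < n" "i \<noteq> j" for i j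
    proof -
      have "edge i j \<in> ?I" by (rule edge_in_pairs[OF that])
      moreover have "A \<omega> $$ (i, j) = X (edge i j) \<omega>"
        using symmetric_matD[OF sym A that(1,2)] by (auto simp: X_def edge_def min_def max_def)
      ultimately show ?thesis
        using binary[of "edge i j" \<omega>] \<open>\<omega> \<in> space M\<close> that(3) by (auto simp: edge_mat_def)
    qed
    then show ?thesis
      unfolding success_def by (subst sdp2'_solution_cong_offdiag[OF A]) auto
  qed
  have "prob {\<omega> \<in> space M. success (\<lambda>e. e \<in> ?I \<and> X e \<omega> = 1)}
      = measure_pmf.prob (edge_law n (block_prob m p q)) {f. success f}"
    unfolding edge_law_def
  proof (rule binary_config_transfer[OF finite_pairs])
    show "indep_vars (\<lambda>_. borel) X ?I" using planted by (simp add: X_def)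
    show "expectation (X e) = block_prob m p q e" if "e \<in> ?I" for e
      using planted that by (auto simp: X_def block_prob_def)
  qed (rule binary)
  moreover have "{\<omega> \<in> space M. {X. sdp2'_solution n K (A \<omega>) X} = {true_cluster_mat m K}}
      = {\<omega> \<in> space M. success (\<lambda>e. e \<in> ?I \<and> X e \<omega> = 1)}"
    using same_solutions by auto
  ultimately show ?thesis
    using edge_law_exact_recovery[OF assms(2-8) assms(10,11) refl refl] assms(12-17)
    by (simp add: success_def scaled_param_def)
qed

end
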